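(* Let $f_0\in C(\mathbb{R}_+)$ be a real-valued function such that $f_0(t)=0$ for $t\ge1$ and $f_0$ is decreasing and concave on $[0,1]$. Then the function $(x_1,x_2)\mapsto f_0(\max\{|x_1|,|x_2|\})$ belongs to $A(\mathbb{R}^2)$ if and only if $$\int_0^1\frac{f_0(1-t)}{t}\ln\frac{2}{t}\,dt<\infty.$$
   Context: $\mathbb{R}_+=[0,+\infty)$. The Wiener algebra $A(\mathbb{R}^2)$ is the set of all functions $f$ of the form $f(x)=\int_{\mathbb{R}^2} g(y)e^{-i(x,y)}\,dy$ ($x\in\mathbb{R}^2$) with $g\in L_1(\mathbb{R}^2)$, where $(x,y)=x_1y_1+x_2y_2$. *)

theory Defs
  imports "HOL-Analysis.Analysis"
begin

(* L_1 consists of complex-valued functions.  Each class in L_1 has a Borel representative,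
   so integrability with respect to lborel loses nothing compared with Lebesgue measurability.
   The representation is required at every point x, not just almost everywhere. *)
definition wiener_algebra :: "('a::euclidean_space \<Rightarrow> complex) set" where
  "wiener_algebra =
     {f. \<exists>g :: 'a \<Rightarrow> complex. integrable lborel g \<and>
           (\<forall>x. f x = (LINT y|lborel. g y * exp (- (\<i> * complex_of_real (x \<bullet> y)))))}"

end

theory Submission
  imports Defs "HOL-Probability.Characteristic_Functions" "HOL-Probability.Sinc_Integral"
begin

text \<open>
  Write \<open>K t = f\<^sub>0 (1 - t)\<close>; this is a continuous, increasing, concave function on \<open>[0, 1]\<close> with
  \<open>K 0 = 0\<close>, and the function in question is the \<open>roof\<close> over the square \<open>[-1, 1]\<^sup>2\<close> whose height at
  a point \<open>x\<close> of the square is \<open>K\<close> of the distance from \<open>x\<close> to its boundary.  Everything is done on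
  \<open>real \<times> real\<close>, where Lebesgue measure is a product, and carried over to \<open>real^2\<close> at the end.

  \<^emph>\<open>The integral is finite if the roof is in the algebra.\<close>  The function \<open>1 / t\<close> on
  \<open>\<epsilon> \<le> \<bar>t\<bar> \<le> 1\<close> is odd, so its Fourier transform is a difference of two sine integrals and is
  bounded uniformly in \<open>\<epsilon>\<close> (\<open>ft_odd_kernel_bounded\<close>).  Place the pole of this kernel at the edge of the
  square, in each of the two coordinates, and integrate the roof against the product.  The roof
  vanishes on the outer side of the edges, so no cancellation takes place and the result is
  \<open>\<integral>\<^sub>\<epsilon>\<^sup>1 \<integral>\<^sub>\<epsilon>\<^sup>1 K (min t u) / (t u) dt du \<ge> \<integral>\<^sub>\<epsilon>\<^sup>1 K t / t \<cdot> ln (1 / t) dt\<close>.  On the other hand,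
  if the roof is the transform of an integrable \<open>g\<close>, the multiplication formula shows that the result
  is at most a constant times the norm of \<open>g\<close>.  Now let \<open>\<epsilon>\<close> tend to \<open>0\<close>
  (\<open>integral_finite_of_wiener\<close>).

  \<^emph>\<open>The roof is in the algebra if the integral is finite.\<close>  By Fourier inversion it suffices that the
  transform of the roof is integrable.  For the truncated profile \<open>K t = min \<tau> t\<close> the roof is an
  integral of indicators of concentric squares, and its transform is
  \<open>4 / (u v) \<cdot> \<integral> sin (s u) sin (s v) ds\<close> over \<open>[1 - \<tau>, 1]\<close>.  Elementary estimates of this integral
  (\<open>integral_sin_sin_bound\<close>) combine into a bound \<open>16 K (1 / max 1 a) w (a, b)\<close>, where \<open>a \<ge> b\<close> are the
  absolute values of the coordinates and the weight \<open>w\<close> is independent of \<open>\<tau>\<close>.  This bound is linear in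
  \<open>K\<close>, and a concave profile is a limit of nonnegative combinations of truncated ones, namely of its
  piecewise linear interpolants; hence the bound holds for every \<open>K\<close> (\<open>ft_roof_bound\<close>).  Integrating the
  weight over \<open>b\<close> produces the factor \<open>(1 + ln a) / a\<close> for \<open>a \<ge> 1\<close>, and the substitution \<open>t = 1 / a\<close> turns
  the remaining integral into the given one (\<open>wiener_of_integral_finite\<close>).
\<close>

section \<open>The Fourier transform and its inversion in the plane\<close>

definition ft :: "('a::euclidean_space \<Rightarrow> complex) \<Rightarrow> 'a \<Rightarrow> complex" where
  "ft F y = (LINT x|lborel. F x * exp (\<i> * complex_of_real (x \<bullet> y)))"

lemma
  fixes a :: "'a::euclidean_space \<Rightarrow> complex" and b :: "'b::euclidean_space \<Rightarrow> complex"
  assumes [simp]: "integrable lborel a" "integrable lborel b"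
  shows integrable_prod_mult: "integrable lborel (\<lambda>x. a (fst x) * b (snd x))"
    and integral_prod_mult: "(LINT x|lborel. a (fst x) * b (snd x)) = integral\<^sup>L lborel a * integral\<^sup>L lborel b"
proof -
  have [measurable]: "a \<in> borel_measurable borel" "b \<in> borel_measurable borel"
    using borel_measurable_integrable[OF assms(1)] borel_measurable_integrable[OF assms(2)] by simp_all
  have *: "integrable (lborel \<Otimes>\<^sub>M lborel) (\<lambda>x. a (fst x) * b (snd x))"
    by (rule lborel_pair.Fubini_integrable) (auto simp: norm_mult)
  then show "integrable lborel (\<lambda>x. a (fst x) * b (snd x))"
    by (simp add: lborel_prod)
  have "integral\<^sup>L (lborel \<Otimes>\<^sub>M lborel) (\<lambda>x. a (fst x) * b (snd x)) = integral\<^sup>L lborel a * integral\<^sup>L lborel b"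
    by (subst lborel_pair.integral_fst'[OF *, symmetric]) simp
  then show "(LINT x|lborel. a (fst x) * b (snd x)) = integral\<^sup>L lborel a * integral\<^sup>L lborel b"
    by (simp add: lborel_prod)
qed

lemma integrable_mult_exp_i:
  fixes F :: "'a::euclidean_space \<Rightarrow> complex"
  assumes "integrable lborel F" "\<phi> \<in> borel_measurable borel"
  shows "integrable lborel (\<lambda>x. F x * exp (\<i> * complex_of_real (\<phi> x)))"
  using assms by (intro Bochner_Integration.integrable_bound[OF assms(1)]) (auto simp: norm_mult)

lemma measurable_ft:
  fixes F :: "'a::euclidean_space \<Rightarrow> complex"
  assumes [measurable]: "F \<in> borel_measurable borel"
  shows "ft F \<in> borel_measurable borel"
  unfolding ft_def[abs_def]
  by (rule lborel.borel_measurable_lebesgue_integral) measurable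

text \<open>
  Fubini's theorem applied to \<open>F x \<cdot> G y \<cdot> exp (\<i> (x \<bullet> y))\<close>.  Both halves of the proof rest on it: inversion
  uses it with a Gaussian for \<open>G\<close>, the converse with a singular kernel for \<open>F\<close>.
\<close>

lemma ft_multiplication_formula:
  fixes F G :: "'a::euclidean_space \<Rightarrow> complex"
  assumes "integrable lborel F" "integrable lborel G"
  shows "(LINT x|lborel. F x * ft G x) = (LINT y|lborel. ft F y * G y)"
proof -
  let ?J = "\<lambda>x y. F x * G y * exp (\<i> * complex_of_real (x \<bullet> y))"
  have "integrable lborel (\<lambda>z. F (fst z) * G (snd z) * exp (\<i> * complex_of_real (fst z \<bullet> snd z)))"
    by (intro integrable_mult_exp_i integrable_prod_mult assms) (simp flip: borel_prod)
  then have *: "integrable (lborel \<Otimes>\<^sub>M lborel) (case_prod ?J)"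
    by (simp add: lborel_prod case_prod_beta')
  have "(LINT x|lborel. F x * ft G x) = (LINT x|lborel. LINT y|lborel. ?J x y)"
    unfolding ft_def by (simp add: mult.assoc inner_commute flip: integral_mult_right_zero)
  also have "\<dots> = (LINT y|lborel. LINT x|lborel. ?J x y)"
    by (rule lborel_pair.Fubini_integral[OF *, symmetric])
  also have "\<dots> = (LINT y|lborel. ft F y * G y)"
    unfolding ft_def by (simp add: mult.commute[of _ "G _"] mult.left_commute[of "F _" "G _"] mult.assoc)
  finally show ?thesis .
qed

lemma integrable_gaussian: "integrable lborel (\<lambda>y::real. complex_of_real (exp (- (y\<^sup>2 / 2))))"
  and ft_gaussian: "ft (\<lambda>y::real. complex_of_real (exp (- (y\<^sup>2 / 2)))) t
       = complex_of_real (sqrt (2 * pi) * exp (- (t\<^sup>2 / 2)))"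
proof -
  have eq: "exp (- (y\<^sup>2 / 2)) = sqrt (2 * pi) * std_normal_density y" for y
    by (simp add: std_normal_density_def)
  have "integrable lborel (\<lambda>y. sqrt (2 * pi) * std_normal_density y)"
    by (intro integrable_mult_right) simp
  then show "integrable lborel (\<lambda>y::real. complex_of_real (exp (- (y\<^sup>2 / 2))))"
    unfolding eq by (rule integrable_of_real)
  have sq: "complex_of_real (sqrt (2 * pi)) * (complex_of_real (sqrt (2 * pi)) * z) = complex_of_real (2 * pi) * z" for z
    by (simp flip: of_real_mult mult.assoc)
  have "char std_normal_distribution t = (LINT y|lborel. std_normal_density y *\<^sub>R iexp (t * y))"
    unfolding char_def by (rule integral_density) auto
  then have "(LINT y|lborel. std_normal_density y *\<^sub>R iexp (y * t)) = exp (- (t\<^sup>2 / 2))"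
    by (simp add: char_std_normal_distribution mult.commute)
  then show "ft (\<lambda>y::real. complex_of_real (exp (- (y\<^sup>2 / 2)))) t
       = complex_of_real (sqrt (2 * pi) * exp (- (t\<^sup>2 / 2)))"
    unfolding ft_def of_real_mult mult.assoc by (simp add: scaleR_conv_of_real eq mult.assoc)
qed

definition gauss2 :: "real \<times> real \<Rightarrow> real" where
  "gauss2 y = exp (- ((y \<bullet> y) / 2))"

lemma gauss2_mult: "complex_of_real (gauss2 y) = complex_of_real (exp (- ((fst y)\<^sup>2 / 2))) * complex_of_real (exp (- ((snd y)\<^sup>2 / 2)))"
  by (cases y) (simp add: gauss2_def power2_eq_square add_divide_distrib flip: exp_add of_real_mult)

lemma gauss2_bounds: "0 \<le> gauss2 y" "gauss2 y \<le> 1"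
  unfolding gauss2_def by simp_all

lemma measurable_gauss2[measurable]: "gauss2 \<in> borel_measurable borel"
  unfolding gauss2_def[abs_def] by measurable

lemma integrable_gauss2: "integrable lborel (\<lambda>y. complex_of_real (gauss2 y))"
  unfolding gauss2_mult by (intro integrable_prod_mult integrable_gaussian)

lemma ft_prod:
  fixes a b :: "real \<Rightarrow> complex"
  assumes "integrable lborel a" "integrable lborel b"
  shows "ft (\<lambda>x. a (fst x) * b (snd x)) y = ft a (fst y) * ft b (snd y)"
proof -
  have "ft (\<lambda>x. a (fst x) * b (snd x)) y =
     (LINT x|lborel. (a (fst x) * exp (\<i> * complex_of_real (fst x * fst y))) * (b (snd x) * exp (\<i> * complex_of_real (snd x * snd y))))"
    unfolding ft_def by (simp add: inner_prod_def exp_add ring_distribs mult_ac)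
  also have "\<dots> = ft a (fst y) * ft b (snd y)"
    unfolding ft_def inner_real_def
    by (rule integral_prod_mult) (intro integrable_mult_exp_i assms; measurable)+
  finally show ?thesis .
qed

lemma ft_gauss2: "ft (\<lambda>y. complex_of_real (gauss2 y)) t = complex_of_real (2 * pi * gauss2 t)"
proof -
  have "complex_of_real (2 * pi) = complex_of_real (sqrt (2 * pi)) * complex_of_real (sqrt (2 * pi))"
    by (simp flip: of_real_mult)
  then show ?thesis
  unfolding gauss2_mult
  by (subst ft_prod) (simp_all add: integrable_gaussian ft_gaussian gauss2_mult)
qed

lemma integrable_scaleR_complex_iff:
  fixes f :: "'a \<Rightarrow> complex"
  assumes "c > 0"
  shows "integrable M (\<lambda>x. c *\<^sub>R f x) \<longleftrightarrow> integrable M f"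
  using integrable_scaleR_right[of c M f] integrable_scaleR_right[of "1/c" M "\<lambda>x. c *\<^sub>R f x"] assms by auto

lemma lborel_integral_scaling:
  fixes f :: "'a::euclidean_space \<Rightarrow> complex"
  assumes f: "f \<in> borel_measurable borel" and c: "c > 0"
  shows "integrable lborel (\<lambda>x. f (t + c *\<^sub>R x)) \<longleftrightarrow> integrable lborel f"
    and "(LINT x|lborel. f x) = c ^ DIM('a) *\<^sub>R (LINT x|lborel. f (t + c *\<^sub>R x))"
proof -
  have L: "(lborel :: 'a measure) = density (distr lborel borel (\<lambda>x. t + c *\<^sub>R x)) (\<lambda>_. ennreal (c ^ DIM('a)))"
    using lborel_affine[of c t] c by simp
  note [measurable] = f
  have "integrable lborel f \<longleftrightarrow> integrable (density (distr lborel borel (\<lambda>x. t + c *\<^sub>R x)) (\<lambda>_. ennreal (c ^ DIM('a)))) f"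
    using L by metis
  also have "\<dots> \<longleftrightarrow> integrable lborel (\<lambda>x. f (t + c *\<^sub>R x))"
    using c by (subst integrable_density) (auto simp: integrable_distr_eq integrable_scaleR_complex_iff)
  finally show "integrable lborel (\<lambda>x. f (t + c *\<^sub>R x)) \<longleftrightarrow> integrable lborel f" ..
  have "integral\<^sup>L lborel f = integral\<^sup>L (density (distr lborel borel (\<lambda>x. t + c *\<^sub>R x)) (\<lambda>_. ennreal (c ^ DIM('a)))) f"
    using L by metis
  also have "\<dots> = c ^ DIM('a) *\<^sub>R (LINT x|lborel. f (t + c *\<^sub>R x))"
    using c by (subst integral_density) (auto simp: integral_distr)
  finally show "(LINT x|lborel. f x) = c ^ DIM('a) *\<^sub>R (LINT x|lborel. f (t + c *\<^sub>R x))" .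
qed

lemma lborel_integral_scaling_plane:
  fixes f :: "real \<times> real \<Rightarrow> complex"
  assumes "f \<in> borel_measurable borel" "c > 0"
  shows "(LINT x|lborel. f x) = c\<^sup>2 *\<^sub>R (LINT x|lborel. f (t + c *\<^sub>R x))"
  using lborel_integral_scaling(2)[OF assms, of t] by (simp add: power2_eq_square)

text \<open>
  The modulation by \<open>exp (- \<i> (x \<bullet> y))\<close> centres the transform at \<open>x\<close>, so that pairing it with \<open>F\<close> yields a
  Gaussian average of \<open>F\<close> around \<open>x\<close>.
\<close>

lemma
  fixes x :: "real \<times> real"
  assumes e: "\<epsilon> > 0"
  defines "G \<equiv> \<lambda>y. complex_of_real (gauss2 (\<epsilon> *\<^sub>R y)) * exp (- (\<i> * complex_of_real (x \<bullet> y)))"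
  shows integrable_modulated_gauss2: "integrable lborel G"
    and ft_modulated_gauss2: "ft G z = complex_of_real (2 * pi * gauss2 ((1/\<epsilon>) *\<^sub>R (z - x)) / \<epsilon>\<^sup>2)"
proof -
  have 1: "integrable lborel (\<lambda>y. complex_of_real (gauss2 (\<epsilon> *\<^sub>R y)))"
    using lborel_integral_scaling(1)[of "\<lambda>y. complex_of_real (gauss2 y)" \<epsilon> 0] e integrable_gauss2 by simp
  show "integrable lborel G"
    using integrable_mult_exp_i[OF 1, of "\<lambda>y. - (x \<bullet> y)"] by (simp add: G_def)
  have "ft G z = (LINT y|lborel. complex_of_real (gauss2 (\<epsilon> *\<^sub>R y)) * exp (\<i> * complex_of_real (y \<bullet> (z - x))))"
    unfolding ft_def G_def by (simp add: mult.assoc inner_diff_right inner_commute right_diff_distrib flip: exp_add)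
  also have "\<dots> = (1/\<epsilon>)^2 *\<^sub>R (LINT y|lborel. complex_of_real (gauss2 y) * exp (\<i> * complex_of_real (y \<bullet> ((1/\<epsilon>) *\<^sub>R (z - x)))))"
    by (subst lborel_integral_scaling_plane[where c="1/\<epsilon>" and t=0]) (use e in auto)
  also have "\<dots> = complex_of_real (2 * pi * gauss2 ((1/\<epsilon>) *\<^sub>R (z - x)) / \<epsilon>\<^sup>2)"
    using ft_gauss2[of "(1/\<epsilon>) *\<^sub>R (z - x)"] unfolding ft_def by (simp add: scaleR_conv_of_real power2_eq_square)
  finally show "ft G z = complex_of_real (2 * pi * gauss2 ((1/\<epsilon>) *\<^sub>R (z - x)) / \<epsilon>\<^sup>2)" .
qed

text \<open>
  Inserting \<open>gauss2 (\<epsilon> y)\<close> into the inversion integral turns it, by the multiplication formula, into a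
  Gaussian average of \<open>F\<close> at scale \<open>\<epsilon>\<close> around \<open>x\<close>.  As \<open>\<epsilon>\<close> tends to \<open>0\<close>, dominated convergence applies on
  both sides: on one because \<open>ft F\<close> is integrable, on the other because \<open>F\<close> is bounded and continuous.
  Continuity also makes the representation valid at every point.
\<close>

theorem fourier_inversion:
  fixes F :: "real \<times> real \<Rightarrow> complex"
  assumes F: "integrable lborel F" and cont: "continuous_on UNIV F" and bnd: "\<And>x. norm (F x) \<le> M"
    and H: "integrable lborel (ft F)"
  shows "F \<in> wiener_algebra"
proof -
  note [measurable] = borel_measurable_integrable[OF F, simplified] borel_measurable_integrable[OF H, simplified]
  have inv: "(LINT y|lborel. ft F y * exp (- (\<i> * complex_of_real (x \<bullet> y)))) = complex_of_real (4 * pi\<^sup>2) * F x" for x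
  proof -
    define \<epsilon> where "\<epsilon> n = 1 / real (Suc n)" for n
    have \<epsilon>: "\<epsilon> n > 0" for n by (simp add: \<epsilon>_def)
    have \<epsilon>0: "\<epsilon> \<longlonglongrightarrow> 0" unfolding \<epsilon>_def using LIMSEQ_inverse_real_of_nat by (simp add: inverse_eq_divide)
    define L where "L n = (LINT y|lborel. ft F y * (complex_of_real (gauss2 (\<epsilon> n *\<^sub>R y)) * exp (- (\<i> * complex_of_real (x \<bullet> y)))))" for n
    have "L \<longlonglongrightarrow> (LINT y|lborel. ft F y * exp (- (\<i> * complex_of_real (x \<bullet> y))))"
      unfolding L_def
    proof (rule integral_dominated_convergence[where w="\<lambda>y. norm (ft F y)"])
      show "integrable lborel (\<lambda>y. norm (ft F y))" using H by simp
      show "AE y in lborel. (\<lambda>n. ft F y * (complex_of_real (gauss2 (\<epsilon> n *\<^sub>R y)) * exp (- (\<i> * complex_of_real (x \<bullet> y)))))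
         \<longlonglongrightarrow> ft F y * exp (- (\<i> * complex_of_real (x \<bullet> y)))"
      proof (rule AE_I2)
        fix y :: "real \<times> real"
        have "(\<lambda>n. ft F y * (complex_of_real (gauss2 (\<epsilon> n *\<^sub>R y)) * exp (- (\<i> * complex_of_real (x \<bullet> y)))))
           \<longlonglongrightarrow> ft F y * (complex_of_real (gauss2 (0 *\<^sub>R y)) * exp (- (\<i> * complex_of_real (x \<bullet> y))))"
          unfolding gauss2_def by (intro tendsto_intros \<epsilon>0) auto
        then show "(\<lambda>n. ft F y * (complex_of_real (gauss2 (\<epsilon> n *\<^sub>R y)) * exp (- (\<i> * complex_of_real (x \<bullet> y)))))
          \<longlonglongrightarrow> ft F y * exp (- (\<i> * complex_of_real (x \<bullet> y)))"
          by (simp add: gauss2_def)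
      qed
      show "AE y in lborel. norm (ft F y * (complex_of_real (gauss2 (\<epsilon> n *\<^sub>R y)) * exp (- (\<i> * complex_of_real (x \<bullet> y)))))
          \<le> norm (ft F y)" for n
        by (auto simp: norm_mult gauss2_bounds intro!: mult_left_le)
    qed simp_all
    moreover have "L \<longlonglongrightarrow> complex_of_real (2 * pi) * (LINT w|lborel. F x * complex_of_real (gauss2 w))"
    proof -
      have eq: "L n = complex_of_real (2 * pi) * (LINT w|lborel. F (x + \<epsilon> n *\<^sub>R w) * complex_of_real (gauss2 w))" for n
      proof -
        have "L n = (LINT z|lborel. F z * complex_of_real (2 * pi * gauss2 ((1/\<epsilon> n) *\<^sub>R (z - x)) / (\<epsilon> n)\<^sup>2))"
          unfolding L_def using ft_multiplication_formula[OF F integrable_modulated_gauss2[OF \<epsilon>[of n], of x], symmetric]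
          by (simp only: ft_modulated_gauss2[OF \<epsilon>])
        also have "\<dots> = (\<epsilon> n)\<^sup>2 *\<^sub>R (LINT w|lborel. F (x + \<epsilon> n *\<^sub>R w) * complex_of_real (2 * pi * gauss2 w / (\<epsilon> n)\<^sup>2))"
          by (subst lborel_integral_scaling_plane[where c="\<epsilon> n" and t=x]) (use \<epsilon>[of n] in auto)
        also have "\<dots> = complex_of_real (2 * pi) * (LINT w|lborel. F (x + \<epsilon> n *\<^sub>R w) * complex_of_real (gauss2 w))"
          using \<epsilon>[of n] by (simp add: scaleR_conv_of_real divide_inverse mult_ac flip: integral_mult_right_zero)
        finally show ?thesis .
      qed
      have "(\<lambda>n. LINT w|lborel. F (x + \<epsilon> n *\<^sub>R w) * complex_of_real (gauss2 w)) \<longlonglongrightarrow> (LINT w|lborel. F x * complex_of_real (gauss2 w))"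
      proof (rule integral_dominated_convergence[where w="\<lambda>w. M * gauss2 w"])
        show "integrable lborel (\<lambda>w. M * gauss2 w)"
          using integrable_gauss2 by (simp add: complex_of_real_integrable_eq)
        show "AE w in lborel. (\<lambda>n. F (x + \<epsilon> n *\<^sub>R w) * complex_of_real (gauss2 w)) \<longlonglongrightarrow> F x * complex_of_real (gauss2 w)"
        proof (rule AE_I2)
          fix w :: "real \<times> real"
          have "(\<lambda>n. x + \<epsilon> n *\<^sub>R w) \<longlonglongrightarrow> x + 0 *\<^sub>R w"
            by (intro tendsto_intros \<epsilon>0)
          then have "(\<lambda>n. F (x + \<epsilon> n *\<^sub>R w)) \<longlonglongrightarrow> F x"
            using cont by (auto intro!: continuous_on_tendsto_compose[OF cont])
          then show "(\<lambda>n. F (x + \<epsilon> n *\<^sub>R w) * complex_of_real (gauss2 w)) \<longlonglongrightarrow> F x * complex_of_real (gauss2 w)"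
            by (intro tendsto_intros)
        qed
        show "AE w in lborel. norm (F (x + \<epsilon> n *\<^sub>R w) * complex_of_real (gauss2 w)) \<le> M * gauss2 w" for n
          by (auto simp: norm_mult gauss2_bounds intro!: mult_right_mono bnd)
      qed simp_all
      from tendsto_mult_left[OF this] show ?thesis
        by (rule Lim_transform_eventually) (intro always_eventually allI eq[symmetric])
    qed
    ultimately have "(LINT y|lborel. ft F y * exp (- (\<i> * complex_of_real (x \<bullet> y)))) =
        complex_of_real (2 * pi) * (LINT w|lborel. F x * complex_of_real (gauss2 w))"
      by (rule LIMSEQ_unique)
    moreover have "(LINT w|lborel. complex_of_real (gauss2 w)) = complex_of_real (2 * pi)"
      using ft_gauss2[of 0] by (simp add: ft_def gauss2_def)
    ultimately show ?thesis
      by (simp add: power2_eq_square mult_ac del: integral_complex_of_real)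
  qed
  have "F x = (LINT y|lborel. complex_of_real (1 / (4 * pi\<^sup>2)) * ft F y * exp (- (\<i> * complex_of_real (x \<bullet> y))))" for x
    unfolding mult.assoc integral_mult_right_zero inv by (simp flip: of_real_mult of_real_power of_real_divide)
  moreover have "integrable lborel (\<lambda>y. complex_of_real (1 / (4 * pi\<^sup>2)) * ft F y)"
    using H by simp
  ultimately show ?thesis
    unfolding wiener_algebra_def by blast
qed

section \<open>From pairs to vectors of length two\<close>

lemma measurable_vec2: "(\<lambda>p::real\<times>real. vector [fst p, snd p] :: real^2) \<in> borel_measurable borel"
proof -
  have eq: "vector [fst p, snd p] = (\<chi> i::2. if i = 1 then fst p else snd p)" for p :: "real \<times> real"
    by (simp add: vec_eq_iff forall_2)
  have "continuous_on UNIV (\<lambda>p::real\<times>real. if i = 1 then fst p else snd p)" for i :: 2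
    by (cases "i = 1") (auto intro!: continuous_intros)
  then show ?thesis
    unfolding eq by (intro borel_measurable_continuous_onI continuous_on_vec_lambda)
qed

lemma lborel_vec2: "(lborel :: (real^2) measure) = distr lborel borel (\<lambda>p::real\<times>real. vector [fst p, snd p])"
proof (rule lborel_eqI)
  note V = measurable_vec2
  show "sets (distr lborel borel (\<lambda>p::real\<times>real. vector [fst p, snd p] :: real^2)) = sets borel"
    by simp
  fix l u :: "real^2"
  assume "\<And>b. b \<in> Basis \<Longrightarrow> l \<bullet> b \<le> u \<bullet> b"
  then have le: "l $ i \<le> u $ i" for i
    using axis_in_Basis_iff[of i "1::real"] by (metis Basis_real_def cart_eq_inner_axis insertCI)
  have "(\<lambda>p::real\<times>real. vector [fst p, snd p] :: real^2) -` box l u = box (l$1, l$2) (u$1, u$2)"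
    by (auto simp: mem_box_cart forall_2 box_prod box_real)
  then have "emeasure (distr lborel borel (\<lambda>p::real\<times>real. vector [fst p, snd p] :: real^2)) (box l u)
     = emeasure lborel (box (l$1, l$2) (u$1, u$2))"
    using V by (subst emeasure_distr) auto
  also have "\<dots> = ennreal ((u$1 - l$1) * (u$2 - l$2))"
    using le by (subst emeasure_lborel_box) (auto simp: Basis_prod_def prod.union_disjoint)
  also have "(u$1 - l$1) * (u$2 - l$2) = (\<Prod>b\<in>Basis. (u - l) \<bullet> b)"
    by (simp add: Basis_vec_def UNIV_2 axis_eq_axis inner_axis)
  finally show "emeasure (distr lborel borel (\<lambda>p::real\<times>real. vector [fst p, snd p] :: real^2)) (box l u) = (\<Prod>b\<in>Basis. (u - l) \<bullet> b)" .
qed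

lemma wiener_algebra_vec2:
  fixes G :: "real \<Rightarrow> real \<Rightarrow> complex"
  shows "(\<lambda>x::real^2. G (x$1) (x$2)) \<in> wiener_algebra \<longleftrightarrow> (\<lambda>x. G (fst x) (snd x)) \<in> wiener_algebra"
proof
  let ?V = "\<lambda>p::real\<times>real. vector [fst p, snd p] :: real^2"
  note [measurable] = measurable_vec2
  have inner_V: "x \<bullet> ?V p = (x$1, x$2) \<bullet> p" for x p
    by (cases p) (simp add: inner_vec_def sum_2)
  { assume "(\<lambda>x::real^2. G (x$1) (x$2)) \<in> wiener_algebra"
    then obtain g where g: "integrable lborel g" and G: "\<And>x::real^2. G (x$1) (x$2) = (LINT y|lborel. g y * exp (- (\<i> * complex_of_real (x \<bullet> y))))"
      unfolding wiener_algebra_def by blast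
    have [measurable]: "g \<in> borel_measurable borel" using borel_measurable_integrable[OF g] by simp
    have "integrable lborel (\<lambda>p. g (?V p))"
      using g by (subst (asm) lborel_vec2) (simp add: integrable_distr_eq)
    moreover have "G (fst x) (snd x) = (LINT y|lborel. g (?V y) * exp (- (\<i> * complex_of_real (x \<bullet> y))))" for x
      using G[of "?V x"] by (subst (asm) lborel_vec2) (simp add: integral_distr inner_V)
    ultimately show "(\<lambda>x. G (fst x) (snd x)) \<in> wiener_algebra"
      unfolding wiener_algebra_def by blast }
  { assume "(\<lambda>x. G (fst x) (snd x)) \<in> wiener_algebra"
    then obtain g where g: "integrable lborel g" and G: "\<And>x. G (fst x) (snd x) = (LINT y|lborel. g y * exp (- (\<i> * complex_of_real (x \<bullet> y))))"
      unfolding wiener_algebra_def by blast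
    have [measurable]: "g \<in> borel_measurable borel" using borel_measurable_integrable[OF g] by simp
    have "integrable lborel (\<lambda>y::real^2. g (y$1, y$2))"
      using g by (subst lborel_vec2) (simp add: integrable_distr_eq)
    moreover have "G (x$1) (x$2) = (LINT y|lborel. g (y$1, y$2) * exp (- (\<i> * complex_of_real (x \<bullet> y))))" for x :: "real^2"
      using G[of "(x$1, x$2)"] by (subst lborel_vec2) (simp add: integral_distr inner_V)
    ultimately show "(\<lambda>x::real^2. G (x$1) (x$2)) \<in> wiener_algebra"
      unfolding wiener_algebra_def by blast }
qed

section \<open>The transform of a truncated pyramid\<close>

definition roof :: "(real \<Rightarrow> real) \<Rightarrow> real \<times> real \<Rightarrow> real" where
  "roof K x = K (max 0 (1 - max \<bar>fst x\<bar> \<bar>snd x\<bar>))"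

lemma ft_indicator:
  assumes "y \<noteq> 0" "s \<ge> 0"
  shows "ft (\<lambda>x::real. complex_of_real (indicator {-s..s} x)) y = complex_of_real (2 * sin (s * y) / y)"
proof -
  have "(LBINT x. indicator {-s..s} x *\<^sub>R exp (\<i> * complex_of_real (x * y)))
      = exp (\<i> * complex_of_real (s * y)) / (\<i> * y) - exp (\<i> * complex_of_real (- s * y)) / (\<i> * y)"
    using assms
    by (intro integral_FTC_atLeastAtMost)
       (auto intro!: derivative_eq_intros continuous_intros simp: has_vector_derivative_complex_iff Re_exp Im_exp Re_divide Im_divide power2_eq_square)
  also have "\<dots> = complex_of_real (2 * sin (s * y) / y)"
    using assms by (simp add: complex_eq_iff Re_exp Im_exp Re_divide Im_divide power2_eq_square)
  finally show ?thesis
    by (simp add: ft_def scaleR_conv_of_real)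
qed

text \<open>
  A square \<open>[-s, s]\<^sup>2\<close> with \<open>1 - \<tau> \<le> s \<le> 1\<close> contains \<open>x\<close> exactly for \<open>s\<close> in an interval whose length is the
  height of the roof at \<open>x\<close>.  Indicators of squares are products, so their transforms are explicit.
\<close>

lemma roof_min_layer_cake:
  assumes "0 < \<tau>" "\<tau> \<le> 1"
  shows "roof (min \<tau>) x = (LBINT s. indicator {1-\<tau>..1} s * (indicator {-s..s} (fst x) * indicator {-s..s} (snd x)))"
proof -
  let ?m = "max \<bar>fst x\<bar> \<bar>snd x\<bar>"
  have "(LBINT s. indicator {1-\<tau>..1} s * (indicator {-s..s} (fst x) * indicator {-s..s} (snd x)))
     = (LBINT s. indicator {max (1-\<tau>) ?m..1} s :: real)"
    by (intro Bochner_Integration.integral_cong refl) (auto simp: indicator_def)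
  also have "\<dots> = roof (min \<tau>) x"
    using assms by (cases "max (1-\<tau>) ?m \<le> 1") (auto simp: roof_def max_def min_def split: if_splits)
  finally show ?thesis ..
qed

lemma ft_roof_min:
  assumes t: "0 < \<tau>" "\<tau> \<le> 1" and y: "fst y \<noteq> 0" "snd y \<noteq> 0"
  shows "ft (\<lambda>x. complex_of_real (roof (min \<tau>) x)) y =
    complex_of_real (4 * integral {1-\<tau>..1} (\<lambda>s. sin (s * fst y) * sin (s * snd y)) / (fst y * snd y))"
proof -
  define J where "J x s = complex_of_real (indicator {1-\<tau>..1} s * (indicator {-s..s} (fst x) * indicator {-s..s} (snd x)))
      * exp (\<i> * complex_of_real (x \<bullet> y))" for x s
  have J: "integrable (lborel \<Otimes>\<^sub>M lborel) (case_prod J)"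
    unfolding lborel_prod
  proof (rule Bochner_Integration.integrable_bound)
    show "integrable lborel (indicator (cbox ((-1,-1),0) ((1,1),1)) :: (real \<times> real) \<times> real \<Rightarrow> real)"
      by (intro integrable_real_indicator) (auto simp: emeasure_lborel_cbox_eq)
    have "closed {p :: (real \<times> real) \<times> real. 1 - \<tau> \<le> snd p \<and> snd p \<le> 1}"
        "closed {p :: (real \<times> real) \<times> real. - snd p \<le> fst (fst p) \<and> fst (fst p) \<le> snd p}"
        "closed {p :: (real \<times> real) \<times> real. - snd p \<le> snd (fst p) \<and> snd (fst p) \<le> snd p}"
      by (intro closed_Collect_conj closed_Collect_le continuous_on_minus continuous_on_fst continuous_on_snd
          continuous_on_id continuous_on_const)+
    note c = this[THEN borel_closed]
    have m1: "(\<lambda>p. indicator {p. 1 - \<tau> \<le> snd p \<and> snd p \<le> 1} p * (indicator {p. -snd p \<le> fst (fst p) \<and> fst (fst p) \<le> snd p} p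
        * indicator {p. -snd p \<le> snd (fst p) \<and> snd (fst p) \<le> snd p} p) :: real) \<in> borel_measurable (borel :: ((real \<times> real) \<times> real) measure)"
      by (intro borel_measurable_times borel_measurable_indicator c)
    have eq: "case_prod J = (\<lambda>p. complex_of_real (indicator {p. 1 - \<tau> \<le> snd p \<and> snd p \<le> 1} p * (indicator {p. -snd p \<le> fst (fst p) \<and> fst (fst p) \<le> snd p} p
        * indicator {p. -snd p \<le> snd (fst p) \<and> snd (fst p) \<le> snd p} p)) * exp (\<i> * complex_of_real (fst p \<bullet> y)))"
      by (auto simp: fun_eq_iff J_def indicator_def)
    have m2: "(\<lambda>p. exp (\<i> * complex_of_real (fst p \<bullet> y))) \<in> borel_measurable (borel :: ((real \<times> real) \<times> real) measure)"
      by (intro borel_measurable_continuous_onI continuous_intros)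
    have "case_prod J \<in> borel_measurable borel"
      unfolding eq by (rule borel_measurable_times[OF measurable_compose[OF m1] m2]) simp
    then show "case_prod J \<in> borel_measurable lborel" by simp
    show "AE p in lborel. norm (case_prod J p) \<le> norm (indicator (cbox ((-1,-1),0) ((1,1),1)) p :: real)"
      using t by (intro AE_I2) (auto simp: J_def norm_mult indicator_def cbox_Pair_eq)
  qed
  have "ft (\<lambda>x. complex_of_real (roof (min \<tau>) x)) y = (LINT x|lborel. LINT s|lborel. J x s)"
    unfolding ft_def roof_min_layer_cake[OF t] J_def
    by (simp only: integral_mult_left_zero integral_complex_of_real)
  also have "\<dots> = (LINT s|lborel. LINT x|lborel. J x s)"
    by (rule lborel_pair.Fubini_integral[OF J, symmetric])
  also have "(\<lambda>s. LINT x|lborel. J x s) = (\<lambda>s. indicator {1-\<tau>..1} s *\<^sub>R complex_of_real (4 * (sin (s * fst y) * sin (s * snd y)) / (fst y * snd y)))"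
  proof
    fix s :: real
    have ii: "integrable lborel (\<lambda>x::real. complex_of_real (indicator {-s..s} x))"
      by (intro integrable_of_real) (cases "-s \<le> s"; simp)
    have "(LINT x|lborel. J x s) = complex_of_real (indicator {1-\<tau>..1} s) *
       ft (\<lambda>x. complex_of_real (indicator {-s..s} (fst x)) * complex_of_real (indicator {-s..s} (snd x))) y"
      unfolding J_def ft_def by (simp add: mult.assoc flip: integral_mult_right_zero)
    also have "\<dots> = complex_of_real (indicator {1-\<tau>..1} s) * (ft (\<lambda>x::real. complex_of_real (indicator {-s..s} x)) (fst y) * ft (\<lambda>x::real. complex_of_real (indicator {-s..s} x)) (snd y))"
      by (subst ft_prod[OF ii ii]) simp
    also have "\<dots> = indicator {1-\<tau>..1} s *\<^sub>R complex_of_real (4 * (sin (s * fst y) * sin (s * snd y)) / (fst y * snd y))"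
      using t y by (cases "s \<in> {1-\<tau>..1}") (auto simp: ft_indicator)
    finally show "(LINT x|lborel. J x s) = indicator {1-\<tau>..1} s *\<^sub>R complex_of_real (4 * (sin (s * fst y) * sin (s * snd y)) / (fst y * snd y))" .
  qed
  also have "(LINT s|lborel. indicator {1-\<tau>..1} s *\<^sub>R complex_of_real (4 * (sin (s * fst y) * sin (s * snd y)) / (fst y * snd y)))
     = complex_of_real (LINT s:{1-\<tau>..1}|lborel. 4 * (sin (s * fst y) * sin (s * snd y)) / (fst y * snd y))"
    unfolding set_lebesgue_integral_def integral_complex_of_real[symmetric]
    by (intro Bochner_Integration.integral_cong refl) (simp add: scaleR_conv_of_real)
  also have "(LINT s:{1-\<tau>..1}|lborel. 4 * (sin (s * fst y) * sin (s * snd y)) / (fst y * snd y))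
     = integral {1-\<tau>..1} (\<lambda>s. 4 * (sin (s * fst y) * sin (s * snd y)) / (fst y * snd y))"
    by (intro set_borel_integral_eq_integral borel_integrable_compact[folded set_integrable_def]) (auto intro!: continuous_intros simp: y set_integrable_def borel_integrable_compact)
  also have "\<dots> = 4 * integral {1-\<tau>..1} (\<lambda>s. sin (s * fst y) * sin (s * snd y)) / (fst y * snd y)"
    by (simp only: integral_divide integral_mult_right)
  finally show ?thesis .
qed

text \<open>
  For \<open>0 \<le> b \<le> a\<close> this is large near the coordinate axis (\<open>b\<close> bounded) and near the diagonal (\<open>a - b\<close>
  bounded), the two directions in which the transform of a square pyramid decays slowly.
\<close>

definition ridge_weight :: "real \<Rightarrow> real \<Rightarrow> real" where
  "ridge_weight a b = (1 / max 1 b + 1 / max 1 (a - b)) / max 1 a"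

lemma sin_le_id: "x \<ge> 0 \<Longrightarrow> \<bar>sin x\<bar> \<le> (x::real)"
  using abs_sin_x_le_abs_x[of x] by simp

text \<open>
  The bounds by multiples of \<open>\<tau>\<close> estimate the integrand.  The fourth writes the product of sines as a difference of
  cosines with frequencies \<open>a - b\<close> and \<open>a + b\<close>.  The fifth integrates the factor with the higher
  frequency by parts and keeps the smallness \<open>\<bar>sin (s b)\<bar> \<le> b\<close>; it is what makes the transform harmless
  near the axes.
\<close>

lemma integral_sin_sin_bound:
  fixes \<tau> a b :: real
  assumes t: "0 < \<tau>" "\<tau> \<le> 1" and ab: "0 < b" "b \<le> a"
  defines "I \<equiv> integral {1-\<tau>..1} (\<lambda>s. sin (s * a) * sin (s * b))"
  shows "\<bar>I\<bar> \<le> \<tau>" "\<bar>I\<bar> \<le> b * \<tau>" "\<bar>I\<bar> \<le> a * b * \<tau>" "a - b \<ge> 1 \<Longrightarrow> \<bar>I\<bar> \<le> 2 / (a - b)" "\<bar>I\<bar> \<le> 3 * b / a"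
proof -
  have bd: "\<bar>integral {1-\<tau>..1} f\<bar> \<le> B * \<tau>" if "continuous_on {1-\<tau>..1} f" "\<And>s. s \<in> {1-\<tau>..1} \<Longrightarrow> \<bar>f s\<bar> \<le> B" for f :: "real \<Rightarrow> real" and B
    using integral_bound[of "1-\<tau>" 1 f B] that t by simp
  have le1: "\<bar>sin (s * c)\<bar> \<le> c" if "s \<in> {1-\<tau>..1}" "c > 0" for s c
  proof -
    have "\<bar>sin (s * c)\<bar> \<le> s * c" using that t by (intro sin_le_id) auto
    also have "\<dots> \<le> 1 * c" using that t by (intro mult_right_mono) auto
    finally show ?thesis by simp
  qed
  have "\<bar>I\<bar> \<le> 1 * \<tau>" unfolding I_def
    by (rule bd) (auto intro!: continuous_intros simp: abs_mult mult_le_one)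
  then show "\<bar>I\<bar> \<le> \<tau>" by simp
  show "\<bar>I\<bar> \<le> b * \<tau>" unfolding I_def
  proof (rule bd)
    fix s assume "s \<in> {1-\<tau>..1}"
    then have "\<bar>sin (s * a)\<bar> * \<bar>sin (s * b)\<bar> \<le> 1 * b" using ab by (intro mult_mono le1) auto
    then show "\<bar>sin (s * a) * sin (s * b)\<bar> \<le> b" by (simp add: abs_mult)
  qed (auto intro!: continuous_intros)
  show "\<bar>I\<bar> \<le> a * b * \<tau>" unfolding I_def
  proof (rule bd)
    fix s assume "s \<in> {1-\<tau>..1}"
    then have "\<bar>sin (s * a)\<bar> * \<bar>sin (s * b)\<bar> \<le> a * b" using ab by (intro mult_mono le1) auto
    then show "\<bar>sin (s * a) * sin (s * b)\<bar> \<le> a * b" by (simp add: abs_mult)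
  qed (auto intro!: continuous_intros)
  show "\<bar>I\<bar> \<le> 2 / (a - b)" if D: "a - b \<ge> 1"
  proof -
    let ?P = "\<lambda>s. (sin (s * (a - b)) / (a - b) - sin (s * (a + b)) / (a + b)) / 2"
    have "((\<lambda>s. sin (s * a) * sin (s * b)) has_integral (?P 1 - ?P (1 - \<tau>))) {1-\<tau>..1}"
    proof (rule fundamental_theorem_of_calculus)
      fix s
      have "sin (s * a) * sin (s * b) = (cos (s * (a - b)) - cos (s * (a + b))) / 2"
        by (simp add: cos_diff cos_add algebra_simps)
      then show "(?P has_vector_derivative (sin (s * a) * sin (s * b))) (at s within {1-\<tau>..1})"
        using D ab unfolding has_real_derivative_iff_has_vector_derivative[symmetric]
        by (auto intro!: derivative_eq_intros)
    qed (use t in auto)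
    then have I: "I = ?P 1 - ?P (1 - \<tau>)" unfolding I_def by (rule integral_unique)
    have q: "\<bar>sin x / c\<bar> \<le> 1 / c" if "c > 0" for x c :: real
      using that by (simp add: divide_right_mono)
    have "1 / (a + b) \<le> 1 / (a - b)" using D ab by (intro divide_left_mono) auto
    moreover have comb: "\<bar>(A - B) / 2 - (C - E) / 2\<bar> \<le> 2 * u"
      if "\<bar>A\<bar> \<le> u" "\<bar>B\<bar> \<le> v" "\<bar>C\<bar> \<le> u" "\<bar>E\<bar> \<le> v" "v \<le> u" for A B C E u v :: real
      using that unfolding abs_le_iff by (simp add: field_simps)
    ultimately have "\<bar>I\<bar> \<le> 2 * (1 / (a - b))"
      unfolding I using D ab by (intro comb[where v="1 / (a + b)"] q) auto
    then show ?thesis by simp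
  qed
  show "\<bar>I\<bar> \<le> 3 * b / a"
  proof -
    let ?P = "\<lambda>s. cos (s * a) * sin (s * b)"
    let ?C = "integral {1-\<tau>..1} (\<lambda>s. cos (s * a) * cos (s * b))"
    have ci: "((\<lambda>s. cos (s * a) * cos (s * b)) has_integral ?C) {1-\<tau>..1}"
      and si: "((\<lambda>s. sin (s * a) * sin (s * b)) has_integral I) {1-\<tau>..1}"
      unfolding I_def by (auto intro!: integrable_integral integrable_continuous_real continuous_intros)
    have "((\<lambda>s. b * (cos (s * a) * cos (s * b)) - a * (sin (s * a) * sin (s * b))) has_integral (?P 1 - ?P (1 - \<tau>))) {1-\<tau>..1}"
    proof (rule fundamental_theorem_of_calculus)
      fix s
      show "(?P has_vector_derivative (b * (cos (s * a) * cos (s * b)) - a * (sin (s * a) * sin (s * b)))) (at s within {1-\<tau>..1})"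
        unfolding has_real_derivative_iff_has_vector_derivative[symmetric]
        by (auto intro!: derivative_eq_intros)
    qed (use t in auto)
    moreover have "((\<lambda>s. b * (cos (s * a) * cos (s * b)) - a * (sin (s * a) * sin (s * b))) has_integral (b * ?C - a * I)) {1-\<tau>..1}"
      by (intro has_integral_diff has_integral_mult_right ci si)
    ultimately have eq: "b * ?C - a * I = ?P 1 - ?P (1 - \<tau>)" by (rule has_integral_unique[symmetric])
    have "\<bar>?C\<bar> \<le> 1 * \<tau>"
      by (rule bd) (auto intro!: continuous_intros simp: abs_mult mult_le_one)
    then have bC: "\<bar>b * ?C\<bar> \<le> b" using t ab by (simp add: abs_mult mult_left_le)
    have "\<bar>?P s\<bar> \<le> b" if "s \<in> {1-\<tau>..1}" for s
    proof -
      have "\<bar>cos (s * a)\<bar> * \<bar>sin (s * b)\<bar> \<le> 1 * b" using ab that by (intro mult_mono le1) auto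
      then show ?thesis by (simp add: abs_mult)
    qed
    from this[of 1] this[of "1 - \<tau>"] have "\<bar>?P 1\<bar> \<le> b" "\<bar>?P (1 - \<tau>)\<bar> \<le> b" using t by auto
    with bC have "\<bar>a * I\<bar> \<le> 3 * b" using eq by linarith
    then show ?thesis using ab by (simp add: abs_mult field_simps)
  qed
qed

text \<open>
  All regimes of the transform in one inequality whose right-hand side depends on \<open>\<tau>\<close> only through the
  value of the profile \<open>min \<tau>\<close> at the point \<open>1 / max 1 a\<close>; this linearity in the profile is what allows
  superposition.  Away from the axis and the diagonal the argument is \<open>min \<tau> (1 / d) \<le> a / d \<cdot> min \<tau> (1 / a)\<close>
  with \<open>d = max 1 (a - b)\<close>, followed by \<open>a / (b d) \<le> 1 / b + 1 / d\<close>.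
\<close>

lemma ft_roof_min_bound_ordered:
  fixes \<tau> a b :: real
  assumes t: "0 < \<tau>" "\<tau> \<le> 1" and ab: "0 < b" "b \<le> a"
  shows "\<bar>4 * integral {1-\<tau>..1} (\<lambda>s. sin (s * a) * sin (s * b)) / (a * b)\<bar> \<le> 16 * min \<tau> (1 / max 1 a) * ridge_weight a b"
proof -
  define I where "I = integral {1-\<tau>..1} (\<lambda>s. sin (s * a) * sin (s * b))"
  define k where "k = min \<tau> (1 / max 1 a)"
  note B = integral_sin_sin_bound[OF t ab, folded I_def]
  have k0: "k \<ge> 0" unfolding k_def using t by simp
  have eq: "\<bar>4 * I / (a * b)\<bar> = 4 * \<bar>I\<bar> / (a * b)" using ab by (simp add: abs_mult)
  have "4 * \<bar>I\<bar> / (a * b) \<le> 16 * k * ridge_weight a b"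
  proof (cases "a \<le> 2")
    case True
    have "4 * \<bar>I\<bar> / (a * b) \<le> 4 * \<tau>" using B(3) ab by (simp add: field_simps)
    also have "4 * \<tau> \<le> 16 * k * (1 / 2)"
    proof -
      have "\<tau> / 2 \<le> 1 / max 1 a" using True t mult_mono[of \<tau> 1 a 2] by (simp add: max_def field_simps)
      then show ?thesis using t by (simp add: k_def)
    qed
    also have "\<dots> \<le> 16 * k * ridge_weight a b"
    proof -
      have "1 / 2 \<le> 1 / max 1 b" "1 / 2 \<le> 1 / max 1 (a - b)" using ab True by (auto simp: field_simps)
      then have "1 \<le> 1 / max 1 b + 1 / max 1 (a - b)" by linarith
      then have "1 / 2 \<le> ridge_weight a b" unfolding ridge_weight_def using True frac_le[of "1 / max 1 b + 1 / max 1 (a - b)" 1 "max 1 a" 2] by simp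
      then show ?thesis using k0 by (intro mult_left_mono) auto
    qed
    finally show ?thesis .
  next
    case False
    then have a: "a > 2" "max 1 a = a" by auto
    have ridge_weight: "ridge_weight a b = (1 / max 1 b + 1 / max 1 (a - b)) / a" unfolding ridge_weight_def a(2) ..
    have bp: "1 / max 1 (a - b) \<ge> 0" by simp
    show ?thesis
    proof (cases "b \<le> 1")
      case True
      have "\<bar>I\<bar> \<le> 3 * b * k"
        unfolding k_def a(2) using B(2) B(5) ab t by (auto simp: min_def)
      then have "4 * \<bar>I\<bar> / (a * b) \<le> 4 * (3 * b * k) / (a * b)"
        using ab by (intro divide_right_mono) auto
      also have "\<dots> = 12 * k * (1 / a)" using ab by simp
      also have "\<dots> \<le> 16 * k * ridge_weight a b"
        unfolding ridge_weight using True k0 a bp by (intro mult_mono divide_right_mono) auto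
      finally show ?thesis .
    next
      case False
      define d where "d = max 1 (a - b)"
      have d: "d \<ge> 1" "d \<le> a" "a \<le> b + d" using False a ab by (auto simp: d_def)
      have "\<bar>I\<bar> \<le> 2 * (a / d * k)"
      proof (cases "\<tau> \<le> 1 / a")
        case True
        have "\<bar>I\<bar> \<le> \<tau>" by (rule B(1))
        also have "\<tau> \<le> a / d * \<tau>" using d t a by (simp add: field_simps)
        finally show ?thesis using True t d a by (simp add: k_def)
      next
        case F: False
        then have k: "k = 1 / a" using a by (simp add: k_def)
        show ?thesis
        proof (cases "a - b \<ge> 1")
          case True
          then show ?thesis using B(4)[OF True] k a by (simp add: d_def)
        next
          case False
          then show ?thesis using B(1) t k a by (simp add: d_def)
        qed
      qed
      then have "4 * \<bar>I\<bar> / (a * b) \<le> 4 * (2 * (a / d * k)) / (a * b)"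
        using ab by (intro divide_right_mono) auto
      also have "\<dots> = 8 * k * (1 / (b * d))" using ab by simp
      also have "\<dots> \<le> 8 * k * ridge_weight a b"
      proof (intro mult_left_mono)
        have "ridge_weight a b = (b + d) / (a * b * d)"
          unfolding ridge_weight d_def[symmetric] using False ab d a by (simp add: field_simps)
        also have "\<dots> \<ge> a / (a * b * d)" using d ab by (intro divide_right_mono) auto
        finally show "1 / (b * d) \<le> ridge_weight a b" using ab by simp
      qed (use k0 in auto)
      also have "\<dots> \<le> 16 * k * ridge_weight a b"
        using k0 ab unfolding ridge_weight by (intro mult_right_mono) auto
      finally show ?thesis .
    qed
  qed
  then show ?thesis using eq unfolding I_def k_def by simp
qed

lemma ft_roof_min_bound:
  fixes y :: "real \<times> real"
  assumes t: "0 < \<tau>" "\<tau> \<le> 1" and y: "fst y \<noteq> 0" "snd y \<noteq> 0"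
  defines "a \<equiv> max \<bar>fst y\<bar> \<bar>snd y\<bar>" and "b \<equiv> min \<bar>fst y\<bar> \<bar>snd y\<bar>"
  shows "norm (ft (\<lambda>x. complex_of_real (roof (min \<tau>) x)) y) \<le> 16 * min \<tau> (1 / max 1 a) * ridge_weight a b"
proof -
  have sn: "sin (s * c) / c = sin (s * \<bar>c\<bar>) / \<bar>c\<bar>" for s c :: real
    by (cases "c \<ge> 0") auto
  have "sin (s * fst y) * sin (s * snd y) / (fst y * snd y) = sin (s * a) * sin (s * b) / (a * b)" for s
    using sn[of s "fst y"] sn[of s "snd y"] unfolding a_def b_def max_def min_def times_divide_times_eq[symmetric] by (auto simp: mult_ac)
  moreover have "integral S f / c = integral S (\<lambda>s. f s / c)" for S c and f :: "real \<Rightarrow> real" by simp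
  ultimately have "4 * integral {1-\<tau>..1} (\<lambda>s. sin (s * fst y) * sin (s * snd y)) / (fst y * snd y)
    = 4 * integral {1-\<tau>..1} (\<lambda>s. sin (s * a) * sin (s * b)) / (a * b)"
    by (simp only: times_divide_eq_right[symmetric])
  moreover have "0 < b" "b \<le> a" using y by (auto simp: a_def b_def)
  ultimately show ?thesis
    using ft_roof_min_bound_ordered[OF t, of b a] ft_roof_min[OF t y] by (simp only: norm_of_real)
qed

section \<open>Concave profiles as superpositions of truncations\<close>

text \<open>
  The piecewise linear interpolant of \<open>K\<close> at the nodes \<open>i / n\<close>, written in the basis \<open>min (i / n)\<close>.  The
  coefficients are the negated second differences of \<open>K\<close>; the minimum with \<open>1\<close> extends \<open>K\<close> as a constant
  beyond \<open>1\<close>, which takes care of the last node.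
\<close>

definition interpolant :: "nat \<Rightarrow> (real \<Rightarrow> real) \<Rightarrow> real \<Rightarrow> real" where
  "interpolant n K t = (\<Sum>i=1..n. real n * (2 * K (real i / n) - K (real (i-1) / n) - K (min 1 (real (i+1) / n))) * min (real i / n) t)"

text \<open>
  Passing from \<open>j\<close> to \<open>j + 1\<close> adds the second differences with index above \<open>j\<close>, and these telescope.
\<close>

lemma sum_second_diff_min:
  fixes a :: "nat \<Rightarrow> real"
  assumes "a 0 = 0" "a (Suc n) = a n" "j \<le> n"
  shows "(\<Sum>i=1..n. (2 * a i - a (i-1) - a (i+1)) * min (real i) (real j)) = a j"
  using assms(3)
proof (induction j)
  case 0
  then show ?case using assms by simp
next
  case (Suc j)
  have *: "(\<Sum>i=1..n. (2 * a i - a (i-1) - a (i+1)) * (if i > j then 1 else 0)) = a (Suc j) - a j" if "j < n" for j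
  proof -
    have "(\<Sum>i=1..n. (2 * a i - a (i-1) - a (i+1)) * (if i > j then 1 else 0))
       = (\<Sum>i=Suc j..n. 2 * a i - a (i-1) - a (i+1))"
      by (rule sum.mono_neutral_cong_right) auto
    also have "\<dots> = (\<Sum>i=Suc j..n. (a i - a (i-1)) - (a (Suc i) - a i))"
      by (rule sum.cong) auto
    also have "\<dots> = a (Suc j) - a j"
    proof -
      have "(\<Sum>i=m..n. (a i - a (i-1)) - (a (Suc i) - a i)) = (a m - a (m-1)) - (a (Suc n) - a n)" if "m \<le> Suc n" "m > 0" for m
        using that sum_Suc_diff[of m n "\<lambda>i. - (a i - a (i-1))"] by (simp add: algebra_simps)
      from this[of "Suc j"] show ?thesis using assms(2) \<open>j < n\<close> by simp
    qed
    finally show ?thesis .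
  qed
  have m: "min (real i) (real (Suc j)) = min (real i) (real j) + (if i > j then 1 else 0)" for i
    by (auto simp: min_def)
  have "(\<Sum>i=1..n. (2 * a i - a (i-1) - a (i+1)) * min (real i) (real (Suc j))) =
     (\<Sum>i=1..n. (2 * a i - a (i-1) - a (i+1)) * min (real i) (real j) + (2 * a i - a (i-1) - a (i+1)) * (if i > j then 1 else 0))"
    by (intro sum.cong refl) (simp only: m distrib_left)
  also have "\<dots> = a j + (a (Suc j) - a j)"
    using Suc *[of j] by (simp only: sum.distrib)
  finally show ?case by simp
qed

lemma integrable_square: "integrable lborel (\<lambda>x::real\<times>real. c * indicator (cbox (-1, -1) (1, 1)) x :: real)"
  by (intro integrable_mult_right integrable_real_indicator) (auto simp: emeasure_lborel_cbox_eq)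

locale concave_profile =
  fixes K :: "real \<Rightarrow> real"
  assumes K0: "K 0 = 0" and mono: "mono_on {0..1} K" and conc: "concave_on {0..1} K"
    and cont: "continuous_on {0..1} K"
begin

lemma K_nonneg: "t \<in> {0..1} \<Longrightarrow> 0 \<le> K t"
  using mono_onD[OF mono, of 0 t] K0 by auto

lemma K_le_1: "t \<in> {0..1} \<Longrightarrow> K t \<le> K 1"
  using mono_onD[OF mono, of t 1] by auto

lemma interpolant_node:
  assumes "n > 0" "j \<le> n"
  shows "interpolant n K (real j / n) = K (real j / n)"
proof -
  define a where "a i = K (min 1 (real i / n))" for i
  have 1: "a (Suc n) = a n" and 2: "a 0 = 0" using assms(1) by (auto simp: a_def K0)
  have a: "a i = K (real i / n)" if "i \<le> n" for i using that assms(1) by (simp add: a_def min_absorb2)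
  have m: "real n * min (real i / n) (real j / n) = min (real i) (real j)" for i
    using assms(1) by (simp add: min_def field_simps)
  have "interpolant n K (real j / n) = (\<Sum>i=1..n. (2 * a i - a (i-1) - a (i+1)) * min (real i) (real j))"
    unfolding interpolant_def m[symmetric] by (intro sum.cong refl) (auto simp: a a_def[of "Suc _"] mult_ac)
  also have "\<dots> = a j" by (rule sum_second_diff_min[OF 2 1 assms(2)])
  finally show ?thesis using assms(2) by (simp add: a)
qed

lemma interpolant_coeff_nonneg:
  assumes "i \<in> {1..n}"
  shows "0 \<le> 2 * K (real i / n) - K (real (i-1) / n) - K (min 1 (real (i+1) / n))"
proof (cases "i = n")
  case True
  then show ?thesis
    using assms mono_onD[OF mono, of "real (n-1) / n" 1] by (auto simp: field_simps)
next
  case False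
  have "(1/2) * K (real (i-1) / n) + (1/2) * K (real (i+1) / n) \<le> K ((1/2) * (real (i-1) / n) + (1/2) * (real (i+1) / n))"
    using assms False concave_onD[OF conc, of "1/2" "real (i-1) / n" "real (i+1) / n"] by (auto simp: field_simps)
  also have "(1/2) * (real (i-1) / n) + (1/2) * (real (i+1) / n) = real i / n"
    using assms by (simp add: of_nat_diff field_simps)
  finally show ?thesis
    using assms False by (simp add: min_absorb2)
qed

lemma interpolant_mono: "s \<le> t \<Longrightarrow> interpolant n K s \<le> interpolant n K t"
  unfolding interpolant_def
  by (intro sum_mono mult_left_mono mult_nonneg_nonneg interpolant_coeff_nonneg) auto

lemma interpolant_0: "interpolant n K 0 = 0"
  unfolding interpolant_def by (intro sum.neutral) auto

lemma interpolant_nonneg: "t \<ge> 0 \<Longrightarrow> 0 \<le> interpolant n K t"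
  using interpolant_mono[of 0 t n] interpolant_0 by simp

lemma interpolant_le:
  assumes "n > 0" shows "interpolant n K t \<le> K 1"
proof -
  have "interpolant n K t \<le> interpolant n K 1"
    unfolding interpolant_def
    by (intro sum_mono mult_left_mono mult_nonneg_nonneg interpolant_coeff_nonneg) (auto simp: min_def field_simps)
  then show ?thesis using interpolant_node[of n n] assms by simp
qed

text \<open>
  The interpolant is increasing and agrees with \<open>K\<close> at the two nodes next to \<open>t\<close>, so it is squeezed between
  two values of \<open>K\<close> whose arguments converge to \<open>t\<close>.
\<close>

lemma interpolant_tendsto:
  assumes t: "t \<in> {0..1}"
  shows "(\<lambda>n. interpolant (Suc n) K t) \<longlonglongrightarrow> K t"
proof -
  define l where "l n = real (nat \<lfloor>Suc n * t\<rfloor>) / Suc n" for n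
  define u where "u n = real (nat \<lceil>Suc n * t\<rceil>) / Suc n" for n
  have nt: "nat \<lfloor>Suc n * t\<rfloor> \<le> Suc n" "nat \<lceil>Suc n * t\<rceil> \<le> Suc n" for n
  proof -
    have "Suc n * t \<le> Suc n" using t mult_left_mono[of t 1 "Suc n"] by simp
    then have "Suc n * t < real (Suc n) + 1" by linarith
    with \<open>Suc n * t \<le> Suc n\<close> show "nat \<lfloor>Suc n * t\<rfloor> \<le> Suc n" "nat \<lceil>Suc n * t\<rceil> \<le> Suc n"
      by (simp_all add: nat_le_iff floor_le_iff ceiling_le_iff del: of_nat_Suc)
  qed
  have f: "real (nat \<lfloor>Suc n * t\<rfloor>) = of_int \<lfloor>Suc n * t\<rfloor>" "real (nat \<lceil>Suc n * t\<rceil>) = of_int \<lceil>Suc n * t\<rceil>" for n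
    using t by (auto simp del: of_nat_Suc)
  have te: "t - 1 / Suc n = (Suc n * t - 1) / Suc n" "t + 1 / Suc n = (Suc n * t + 1) / Suc n"
    "t = (Suc n * t) / Suc n" for n
    by (simp_all add: diff_divide_distrib add_divide_distrib del: of_nat_Suc)
  have l: "t - 1 / Suc n \<le> l n" "l n \<le> t" for n
    unfolding l_def f te(1) by (intro divide_right_mono; linarith) (subst (2) te(3)[of n], intro divide_right_mono, auto simp del: of_nat_Suc)
  have l01: "l n \<in> {0..1}" for n
    using nt(1)[of n] unfolding l_def by (simp del: of_nat_Suc)
  have u: "u n \<le> t + 1 / Suc n" "t \<le> u n" for n
    unfolding u_def f te(2) by (intro divide_right_mono; linarith) (subst (1) te(3)[of n], intro divide_right_mono, auto simp del: of_nat_Suc)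
  have u01: "u n \<in> {0..1}" for n
    using nt(2)[of n] unfolding u_def by (simp del: of_nat_Suc)
  have e: "(\<lambda>n. 1 / real (Suc n)) \<longlonglongrightarrow> 0"
    using LIMSEQ_inverse_real_of_nat by (simp add: inverse_eq_divide)
  have "l \<longlonglongrightarrow> t"
    by (rule tendsto_sandwich[of "\<lambda>n. t - 1 / Suc n" _ _ "\<lambda>_. t"]) (use l tendsto_diff[OF tendsto_const e, of t] in auto)
  then have Kl: "(\<lambda>n. K (l n)) \<longlonglongrightarrow> K t"
    using l01 t by (intro continuous_on_tendsto_compose[OF cont]) auto
  have "u \<longlonglongrightarrow> t"
    by (rule tendsto_sandwich[of "\<lambda>_. t" _ _ "\<lambda>n. t + 1 / Suc n"]) (use u tendsto_add[OF tendsto_const e, of t] in auto)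
  then have Ku: "(\<lambda>n. K (u n)) \<longlonglongrightarrow> K t"
    using u01 t by (intro continuous_on_tendsto_compose[OF cont]) auto
  have "K (l n) \<le> interpolant (Suc n) K t" for n
    using interpolant_mono[OF l(2)[of n], of "Suc n"] interpolant_node[of "Suc n", OF _ nt(1)] by (simp add: l_def)
  moreover have "interpolant (Suc n) K t \<le> K (u n)" for n
    using interpolant_mono[OF u(2)[of n], of "Suc n"] interpolant_node[of "Suc n", OF _ nt(2)] by (simp add: u_def)
  ultimately show ?thesis
    by (intro tendsto_sandwich[OF _ _ Kl Ku]) auto
qed

lemma roof_arg: "max 0 (1 - max \<bar>fst x\<bar> \<bar>snd x\<bar>) \<in> {0..1::real}"
  by auto

lemma continuous_roof: "continuous_on UNIV (roof K)"
  unfolding roof_def[abs_def]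
  by (rule continuous_on_compose2[OF cont]) (auto intro!: continuous_intros)

lemma roof_nonneg: "0 \<le> roof K x" and roof_le: "roof K x \<le> K 1"
  unfolding roof_def using roof_arg K_nonneg K_le_1 by auto

lemma roof_outside: "x \<notin> cbox (-1, -1) (1, 1) \<Longrightarrow> roof K x = 0"
  by (cases x) (auto simp: roof_def K0 cbox_Pair_eq max_def split: if_splits)

lemma measurable_roof[measurable]: "roof K \<in> borel_measurable borel"
  by (intro borel_measurable_continuous_onI continuous_roof)

lemma integrable_roof: "integrable lborel (\<lambda>x. complex_of_real (roof K x))"
proof (rule Bochner_Integration.integrable_bound[OF integrable_square[of "K 1"]])
  show "AE x in lborel. norm (complex_of_real (roof K x)) \<le> norm (K 1 * indicator (cbox (-1, -1) (1, 1)) x :: real)"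
  proof (rule AE_I2)
    fix x
    show "norm (complex_of_real (roof K x)) \<le> norm (K 1 * indicator (cbox (-1, -1) (1, 1)) x :: real)"
      using roof_nonneg[of x] roof_le[of x] roof_outside[of x] by (cases "x \<in> cbox (-1, -1) (1, 1)") auto
  qed
qed simp

end

lemma concave_profile_min:
  assumes "0 < \<tau>" shows "concave_profile (min \<tau>)"
proof
  show "concave_on {0..1} (min \<tau>)"
    unfolding concave_on_iff
  proof (intro conjI ballI allI impI)
    fix x y u v :: real assume "0 \<le> u" "0 \<le> v" "u + v = 1"
    then have "u * min \<tau> x + v * min \<tau> y \<le> u * \<tau> + v * \<tau>" "u * min \<tau> x + v * min \<tau> y \<le> u * x + v * y"
      by (intro add_mono mult_left_mono; simp)+
    moreover have "u * \<tau> + v * \<tau> = \<tau>" using \<open>u + v = 1\<close> by (simp flip: distrib_right)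
    ultimately show "u * min \<tau> x + v * min \<tau> y \<le> min \<tau> (u *\<^sub>R x + v *\<^sub>R y)" by simp
  qed simp
qed (use assms in \<open>auto intro!: continuous_intros mono_onI\<close>)

context concave_profile
begin

text \<open>
  The bound for truncated profiles passes to the interpolants because their coefficients are
  nonnegative, and to \<open>K\<close> in the limit because the interpolants are uniformly bounded by \<open>K 1\<close>.
\<close>

theorem ft_roof_bound:
  assumes y: "fst y \<noteq> 0" "snd y \<noteq> 0"
  defines "a \<equiv> max \<bar>fst y\<bar> \<bar>snd y\<bar>" and "b \<equiv> min \<bar>fst y\<bar> \<bar>snd y\<bar>"
  shows "norm (ft (\<lambda>x. complex_of_real (roof K x)) y) \<le> 16 * K (1 / max 1 a) * ridge_weight a b"
proof -
  let ?T = "1 / max 1 a"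
  have T: "?T \<in> {0..1}" by auto
  have weight_nonneg: "ridge_weight a b \<ge> 0" unfolding ridge_weight_def by simp
  define F where "F n x = complex_of_real (roof (interpolant (Suc n) K) x)" for n x
  have bnd: "norm (ft (F n) y) \<le> 16 * interpolant (Suc n) K ?T * ridge_weight a b" for n
  proof -
    define c where "c i = real (Suc n) * (2 * K (real i / Suc n) - K (real (i-1) / Suc n) - K (min 1 (real (i+1) / Suc n)))" for i
    have c: "c i \<ge> 0" if "i \<in> {1..Suc n}" for i
      unfolding c_def by (intro mult_nonneg_nonneg interpolant_coeff_nonneg that) simp
    have it: "interpolant (Suc n) K t = (\<Sum>i=1..Suc n. c i * min (real i / Suc n) t)" for t
      unfolding interpolant_def c_def by (rule refl)
    have int: "integrable lborel (\<lambda>x. complex_of_real (roof (min (real i / Suc n)) x) * exp (\<i> * complex_of_real (x \<bullet> y)))"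
      if "i \<in> {1..Suc n}" for i
      using that by (intro integrable_mult_exp_i concave_profile.integrable_roof concave_profile_min) auto
    have "ft (F n) y = (LINT x|lborel. (\<Sum>i=1..Suc n. complex_of_real (c i) * (complex_of_real (roof (min (real i / Suc n)) x) * exp (\<i> * complex_of_real (x \<bullet> y)))))"
      unfolding ft_def F_def roof_def it of_real_sum of_real_mult sum_distrib_right mult.assoc ..
    also have "\<dots> = (\<Sum>i=1..Suc n. complex_of_real (c i) * ft (\<lambda>x. complex_of_real (roof (min (real i / Suc n)) x)) y)"
      unfolding ft_def by (subst Bochner_Integration.integral_sum) (use int in auto)
    also have "norm \<dots> \<le> (\<Sum>i=1..Suc n. c i * (16 * min (real i / Suc n) ?T * ridge_weight a b))"
    proof (intro sum_norm_le)
      fix i assume i: "i \<in> {1..Suc n}"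
      have "norm (ft (\<lambda>x. complex_of_real (roof (min (real i / Suc n)) x)) y) \<le> 16 * min (real i / Suc n) ?T * ridge_weight a b"
        unfolding a_def b_def using i by (intro ft_roof_min_bound y) auto
      then show "norm (complex_of_real (c i) * ft (\<lambda>x. complex_of_real (roof (min (real i / Suc n)) x)) y)
         \<le> c i * (16 * min (real i / Suc n) ?T * ridge_weight a b)"
        using c[OF i] by (simp only: norm_mult norm_of_real abs_of_nonneg mult_left_mono)
    qed
    also have "\<dots> = 16 * interpolant (Suc n) K ?T * ridge_weight a b"
      unfolding it sum_distrib_left sum_distrib_right by (intro sum.cong refl) (simp only: mult_ac)
    finally show ?thesis .
  qed
  have "(\<lambda>n. ft (F n) y) \<longlonglongrightarrow> ft (\<lambda>x. complex_of_real (roof K x)) y"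
    unfolding ft_def
  proof (rule integral_dominated_convergence[OF _ _ integrable_square[of "K 1"]])
    have meas: "F n \<in> borel_measurable borel" for n
      unfolding F_def[abs_def] roof_def interpolant_def
      by (intro borel_measurable_continuous_onI continuous_intros)
    show "(\<lambda>x. F n x * exp (\<i> * complex_of_real (x \<bullet> y))) \<in> borel_measurable lborel" for n
      using meas[of n] by simp
    show "AE x in lborel. (\<lambda>n. F n x * exp (\<i> * complex_of_real (x \<bullet> y))) \<longlonglongrightarrow> complex_of_real (roof K x) * exp (\<i> * complex_of_real (x \<bullet> y))"
      unfolding F_def roof_def by (intro AE_I2 tendsto_intros interpolant_tendsto roof_arg)
    have "norm (F n x) \<le> K 1 * indicator (cbox (-1, -1) (1, 1)) x" for n x
    proof (cases "x \<in> cbox (-1, -1) (1, 1)")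
      case True
      then show ?thesis unfolding F_def roof_def using interpolant_nonneg interpolant_le[of "Suc n"] by simp
    next
      case False
      then have "max 0 (1 - max \<bar>fst x\<bar> \<bar>snd x\<bar>) = 0"
        by (cases x) (auto simp: cbox_Pair_eq max_def split: if_splits)
      then show ?thesis using False unfolding F_def roof_def by (simp add: interpolant_0)
    qed
    then show "AE x in lborel. norm (F n x * exp (\<i> * complex_of_real (x \<bullet> y))) \<le> K 1 * indicator (cbox (-1, -1) (1, 1)) x" for n
      by (simp add: norm_mult)
  qed simp
  moreover have "(\<lambda>n. 16 * interpolant (Suc n) K ?T * ridge_weight a b) \<longlonglongrightarrow> 16 * K ?T * ridge_weight a b"
    by (intro tendsto_intros interpolant_tendsto T)
  ultimately show ?thesis
    using bnd by (intro LIMSEQ_le[OF tendsto_norm]) auto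
qed

end

section \<open>Finiteness of the integral\<close>

text \<open>This is \<open>1 / t\<close> on \<open>\<epsilon> \<le> \<bar>t\<bar> \<le> 1\<close>, a truncated Hilbert kernel.\<close>

definition odd_kernel :: "real \<Rightarrow> real \<Rightarrow> real" where
  "odd_kernel \<epsilon> t = (indicator {\<epsilon>..1} t + indicator {\<epsilon>..1} (- t)) / t"

lemma integrable_half_kernel:
  assumes "0 < \<epsilon>"
  shows "integrable lborel (\<lambda>t::real. complex_of_real (indicator {\<epsilon>..1} t / t))"
proof -
  have "set_integrable lborel {\<epsilon>..1} (\<lambda>t::real. 1 / t)"
    by (rule borel_integrable_atLeastAtMost') (use assms in \<open>auto intro!: continuous_intros\<close>)
  then show ?thesis
    unfolding set_integrable_def by (intro integrable_of_real) simp
qed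

lemma odd_kernel_split:
  "complex_of_real (odd_kernel \<epsilon> t) = complex_of_real (indicator {\<epsilon>..1} t / t) - complex_of_real (indicator {\<epsilon>..1} (- t) / (- t))"
  by (simp add: odd_kernel_def add_divide_distrib)

lemma integrable_odd_kernel:
  assumes "0 < \<epsilon>"
  shows "integrable lborel (\<lambda>t. complex_of_real (odd_kernel \<epsilon> t))"
  unfolding odd_kernel_split
  using lborel_integrable_real_affine[OF integrable_half_kernel[OF assms], of "-1" 0]
  by (intro Bochner_Integration.integrable_diff integrable_half_kernel assms) simp

lemma ft_odd_kernel:
  assumes e: "0 < \<epsilon>" "\<epsilon> \<le> 1"
  shows "ft (\<lambda>t. complex_of_real (odd_kernel \<epsilon> t)) y = \<i> * complex_of_real (2 * (Si y - Si (\<epsilon> * y)))"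
proof -
  let ?h = "\<lambda>t::real. complex_of_real (indicator {\<epsilon>..1} t / t)"
  have ih: "integrable lborel ?h" by (rule integrable_half_kernel[OF e(1)])
  have i1: "integrable lborel (\<lambda>t. ?h t * exp (\<i> * complex_of_real (t * u)))" for u
    by (intro integrable_mult_exp_i ih) measurable
  have i2: "integrable lborel (\<lambda>t. ?h (- t) * exp (\<i> * complex_of_real (t * u)))" for u
    using lborel_integrable_real_affine[OF i1, of "-1" 0 "-u"] by simp
  have "ft (\<lambda>t. complex_of_real (odd_kernel \<epsilon> t)) y =
     (LINT t|lborel. ?h t * exp (\<i> * complex_of_real (t * y))) - (LINT t|lborel. ?h (- t) * exp (\<i> * complex_of_real (t * y)))"
    unfolding ft_def odd_kernel_split left_diff_distrib inner_real_def
    by (rule Bochner_Integration.integral_diff[OF i1 i2])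
  also have "(LINT t|lborel. ?h (- t) * exp (\<i> * complex_of_real (t * y))) = (LINT t|lborel. ?h t * exp (\<i> * complex_of_real (t * - y)))"
    by (subst lborel_integral_real_affine[where c="-1" and t=0]) simp_all
  also have "(LINT t|lborel. ?h t * exp (\<i> * complex_of_real (t * y))) - \<dots>
     = (LINT t|lborel. \<i> * complex_of_real (indicator {\<epsilon>..1} t *\<^sub>R (2 * (sin (t * y) / t))))"
    unfolding Bochner_Integration.integral_diff[OF i1 i1, symmetric]
    by (intro Bochner_Integration.integral_cong refl)
       (auto simp: complex_eq_iff Re_exp Im_exp indicator_def)
  also have "\<dots> = \<i> * complex_of_real (LINT t|lborel. indicator {\<epsilon>..1} t *\<^sub>R (2 * (sin (t * y) / t)))"
    by (simp only: integral_mult_right_zero integral_complex_of_real)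
  also have "(LINT t|lborel. indicator {\<epsilon>..1} t *\<^sub>R (2 * (sin (t * y) / t))) = 2 * Si (1 * y) - 2 * Si (\<epsilon> * y)"
  proof (intro integral_FTC_atLeastAtMost e)
    show "continuous_on {\<epsilon>..1} (\<lambda>t. 2 * (sin (t * y) / t))"
      using e by (auto intro!: continuous_intros)
    fix t assume t: "\<epsilon> \<le> t" "t \<le> 1"
    have "((\<lambda>t. Si (t * y)) has_real_derivative sinc (t * y) * y) (at t within {\<epsilon>..1})"
      by (rule DERIV_chain'[OF _ DERIV_Si]) (auto intro!: derivative_eq_intros)
    then have "((\<lambda>t. 2 * Si (t * y)) has_real_derivative 2 * (sinc (t * y) * y)) (at t within {\<epsilon>..1})"
      by (rule DERIV_cmult)
    moreover have "2 * (sinc (t * y) * y) = 2 * (sin (t * y) / t)" using t e by auto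
    ultimately show "((\<lambda>t. 2 * Si (t * y)) has_vector_derivative 2 * (sin (t * y) / t)) (at t within {\<epsilon>..1})"
      by (simp only: has_real_derivative_iff_has_vector_derivative)
  qed
  finally show ?thesis by (simp add: right_diff_distrib)
qed

lemma ft_odd_kernel_bounded: "\<exists>B. \<forall>\<epsilon> y. 0 < \<epsilon> \<longrightarrow> \<epsilon> \<le> 1 \<longrightarrow> norm (ft (\<lambda>t. complex_of_real (odd_kernel \<epsilon> t)) y) \<le> B"
proof -
  obtain B where B: "\<And>T. \<bar>Si T\<bar> \<le> B" using bounded_Si by blast
  have "\<bar>2 * (Si y - Si (\<epsilon> * y))\<bar> \<le> 4 * B" for \<epsilon> y
  proof -
    have "\<bar>Si y - Si (\<epsilon> * y)\<bar> \<le> B + B"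
      by (rule order_trans[OF abs_triangle_ineq4 add_mono]) (rule B)+
    then show ?thesis by (simp add: abs_mult)
  qed
  then show ?thesis
    by (intro exI[of _ "4 * B"]) (auto simp: ft_odd_kernel norm_mult simp del: of_real_mult of_real_diff)
qed

context concave_profile
begin

lemma measurable_profile_clamped[measurable]: "(\<lambda>t. K (max 0 (min 1 t))) \<in> borel_measurable borel"
  by (intro borel_measurable_continuous_onI continuous_on_compose2[OF cont]) (auto intro!: continuous_intros)

text \<open>
  With the pole at the edge of the square, the negative half of the kernel meets only points outside
  the square, where the roof vanishes; this removes all cancellation.
\<close>

lemma odd_kernel_times_roof:
  assumes "0 < \<epsilon>"
  shows "odd_kernel \<epsilon> t1 * odd_kernel \<epsilon> t2 * roof K (1 - t1, 1 - t2) =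
    (if t1 \<in> {\<epsilon>..1} \<and> t2 \<in> {\<epsilon>..1} then K (min t1 t2) / (t1 * t2) else 0)"
proof (cases "t1 > 0 \<and> t2 > 0")
  case True
  then show ?thesis using assms by (auto simp: odd_kernel_def roof_def indicator_def max_def min_def)
next
  case False
  then have "max 0 (1 - max \<bar>1 - t1\<bar> \<bar>1 - t2\<bar>) = 0" by (auto simp: max_def)
  then have "roof K (1 - t1, 1 - t2) = 0" unfolding roof_def fst_conv snd_conv by (simp only: K0)
  then show ?thesis using False assms by auto
qed

text \<open>
  The integral of the roof against the product kernel \<open>N\<close> is bounded by means of the multiplication
  formula.  Restricting it to \<open>t1 \<le> t2\<close>, where the minimum is \<open>t1\<close>, and integrating over \<open>t2\<close> leaves
  the logarithm.
\<close>

lemma truncated_integral_bounded: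
  assumes "(\<lambda>x. complex_of_real (roof K x)) \<in> wiener_algebra"
  obtains M :: real where "\<And>\<epsilon>. 0 < \<epsilon> \<Longrightarrow> \<epsilon> \<le> 1 \<Longrightarrow> (\<integral>\<^sup>+t\<in>{\<epsilon>..1}. ennreal (K t / t * ln (1 / t)) \<partial>lborel) \<le> ennreal M"
proof -
  obtain g where g: "integrable lborel g" and rep: "\<And>x. complex_of_real (roof K x) = (LINT y|lborel. g y * exp (- (\<i> * complex_of_real (x \<bullet> y))))"
    using assms unfolding wiener_algebra_def by blast
  obtain B where B: "\<And>\<epsilon> y. 0 < \<epsilon> \<Longrightarrow> \<epsilon> \<le> 1 \<Longrightarrow> norm (ft (\<lambda>t. complex_of_real (odd_kernel \<epsilon> t)) y) \<le> B"
    using ft_odd_kernel_bounded by blast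
  have B0: "B \<ge> 0" using order_trans[OF norm_ge_zero B[of 1 0]] by simp
  \<comment> \<open>The modulation moves the corner \<open>(1, 1)\<close> of the square to the origin.\<close>
  define g' where "g' y = g y * exp (\<i> * complex_of_real (- ((1,1) \<bullet> y)))" for y
  have g': "integrable lborel g'"
    unfolding g'_def by (intro integrable_mult_exp_i g) measurable
  have ft_g': "ft g' t = complex_of_real (roof K ((1,1) - t))" for t
    unfolding rep ft_def g'_def mult.assoc exp_add[symmetric]
    by (intro Bochner_Integration.integral_cong refl arg_cong2[where f="(*)"] arg_cong[where f=exp])
       (simp add: inner_diff_left algebra_simps inner_commute)
  show thesis
  proof (rule that)
    fix \<epsilon> :: real assume e: "0 < \<epsilon>" "\<epsilon> \<le> 1"
    define N where "N t = complex_of_real (odd_kernel \<epsilon> (fst t)) * complex_of_real (odd_kernel \<epsilon> (snd t))" for t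
    note iok = integrable_odd_kernel[OF e(1)]
    have N: "integrable lborel N" unfolding N_def by (intro integrable_prod_mult iok)
    define R where "R t = (if fst t \<in> {\<epsilon>..1} \<and> snd t \<in> {\<epsilon>..1} then K (min (fst t) (snd t)) / (fst t * snd t) else 0)" for t
    have NR: "N t * ft g' t = complex_of_real (R t)" for t
      unfolding ft_g' N_def R_def using odd_kernel_times_roof[OF e(1), of "fst t" "snd t", symmetric]
      by (cases t) (simp only: of_real_mult fst_conv snd_conv diff_Pair)
    have R0: "R t \<ge> 0" for t
      unfolding R_def using e K_nonneg by (auto intro!: divide_nonneg_nonneg)
    have "integrable lborel (\<lambda>t. N t * complex_of_real (roof K ((1,1) - t)))"
    proof (rule Bochner_Integration.integrable_bound)
      show "integrable lborel (\<lambda>t. K 1 * norm (N t))" using N by simp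
      show "(\<lambda>t. N t * complex_of_real (roof K ((1,1) - t))) \<in> borel_measurable lborel"
        using borel_measurable_integrable[OF N] by simp
      show "AE t in lborel. norm (N t * complex_of_real (roof K ((1,1) - t))) \<le> norm (K 1 * norm (N t))"
      proof (rule AE_I2)
        fix t
        have "norm (N t) * \<bar>roof K ((1,1) - t)\<bar> \<le> norm (N t) * \<bar>K 1\<bar>"
          using roof_nonneg roof_le[of "(1,1) - t"] by (intro mult_left_mono) auto
        then show "norm (N t * complex_of_real (roof K ((1,1) - t))) \<le> norm (K 1 * norm (N t))"
          by (simp add: norm_mult abs_mult mult.commute)
      qed
    qed
    then have iR: "integrable lborel R"
      unfolding NR[unfolded ft_g'] by (simp only: complex_of_real_integrable_eq)
    have "complex_of_real (integral\<^sup>L lborel R) = (LINT y|lborel. ft N y * g' y)"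
      using ft_multiplication_formula[OF N g'] unfolding NR by (simp only: integral_complex_of_real)
    then have "\<bar>integral\<^sup>L lborel R\<bar> = norm (LINT y|lborel. ft N y * g' y)"
      by (metis norm_of_real)
    also have "\<dots> \<le> (LINT y|lborel. B\<^sup>2 * norm (g y))"
    proof (rule Bochner_Integration.integral_norm_bound_integral)
      show bb: "norm (ft N y * g' y) \<le> B\<^sup>2 * norm (g y)" for y
      proof -
        have "ft N y = ft (\<lambda>t. complex_of_real (odd_kernel \<epsilon> t)) (fst y) * ft (\<lambda>t. complex_of_real (odd_kernel \<epsilon> t)) (snd y)"
          unfolding N_def by (rule ft_prod[OF iok iok])
        then have "norm (ft N y) \<le> B * B"
          using B[OF e] B0 by (simp add: norm_mult mult_mono)
        then have "norm (ft N y) * norm (g y) \<le> B * B * norm (g y)" by (intro mult_right_mono) auto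
        then show ?thesis by (simp add: norm_mult g'_def power2_eq_square)
      qed
      show "integrable lborel (\<lambda>y. B\<^sup>2 * norm (g y))" using g by simp
      then show "integrable lborel (\<lambda>y. ft N y * g' y)"
      proof (rule Bochner_Integration.integrable_bound)
        show "(\<lambda>y. ft N y * g' y) \<in> borel_measurable lborel"
          using measurable_ft[OF borel_measurable_integrable[OF N, simplified]] borel_measurable_integrable[OF g'] by simp
        show "AE y in lborel. norm (ft N y * g' y) \<le> norm (B\<^sup>2 * norm (g y))"
          using bb by (intro AE_I2) (simp add: abs_of_nonneg)
      qed
    qed
    finally have IR: "integral\<^sup>L lborel R \<le> (LINT y|lborel. B\<^sup>2 * norm (g y))" by simp
    have [measurable]: "R \<in> borel_measurable borel" using borel_measurable_integrable[OF iR] by simp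
    have "(\<integral>\<^sup>+t\<in>{\<epsilon>..1}. ennreal (K t / t * ln (1 / t)) \<partial>lborel) \<le> (\<integral>\<^sup>+t1. (\<integral>\<^sup>+t2. ennreal (R (t1, t2)) \<partial>lborel) \<partial>lborel)"
    proof (rule nn_integral_mono)
      fix t1 :: real
      show "ennreal (K t1 / t1 * ln (1 / t1)) * indicator {\<epsilon>..1} t1 \<le> (\<integral>\<^sup>+t2. ennreal (R (t1, t2)) \<partial>lborel)"
      proof (cases "t1 \<in> {\<epsilon>..1}")
        case t: True
        have "(\<integral>\<^sup>+t2. ennreal (1 / t2) * indicator {t1..1} t2 \<partial>lborel) = ln 1 - ln t1"
          using t e by (intro nn_integral_FTC_Icc) (auto intro!: derivative_eq_intros)
        then have "ennreal (K t1 / t1) * ennreal (ln (1 / t1)) = ennreal (K t1 / t1) * (\<integral>\<^sup>+t2. ennreal (1 / t2) * indicator {t1..1} t2 \<partial>lborel)"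
          using t e by (simp add: ln_div)
        also have "\<dots> = (\<integral>\<^sup>+t2. ennreal (K t1 / t1) * (ennreal (1 / t2) * indicator {t1..1} t2) \<partial>lborel)"
          by (rule nn_integral_cmult[symmetric]) simp
        also have "\<dots> \<le> (\<integral>\<^sup>+t2. ennreal (R (t1, t2)) \<partial>lborel)"
          using t e K_nonneg[of t1]
          by (intro nn_integral_mono) (auto simp: R_def indicator_def min_absorb1 simp flip: ennreal_mult)
        finally have "ennreal (K t1 / t1) * ennreal (ln (1 / t1)) \<le> (\<integral>\<^sup>+t2. ennreal (R (t1, t2)) \<partial>lborel)" .
        moreover have "ennreal (K t1 / t1 * ln (1 / t1)) = ennreal (K t1 / t1) * ennreal (ln (1 / t1))"
          using t e K_nonneg[of t1] by (intro ennreal_mult) auto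
        ultimately show ?thesis using t by simp
      qed simp
    qed
    also have "\<dots> = (\<integral>\<^sup>+t. ennreal (R t) \<partial>(lborel \<Otimes>\<^sub>M lborel))"
      by (rule lborel.nn_integral_fst) (simp add: lborel_prod)
    also have "\<dots> = ennreal (integral\<^sup>L lborel R)"
      unfolding lborel_prod by (rule nn_integral_eq_integral[OF iR]) (simp add: R0)
    also have "\<dots> \<le> ennreal (LINT y|lborel. B\<^sup>2 * norm (g y))"
      using IR by (rule ennreal_leI)
    finally show "(\<integral>\<^sup>+t\<in>{\<epsilon>..1}. ennreal (K t / t * ln (1 / t)) \<partial>lborel) \<le> ennreal (LINT y|lborel. B\<^sup>2 * norm (g y))" .
  qed
qed

text \<open>
  Monotone convergence gives the integral with \<open>ln (1 / t)\<close>.  The difference \<open>ln 2\<close> to \<open>ln (2 / t)\<close> is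
  dominated by \<open>ln (1 / t)\<close> for \<open>t \<le> 1 / 2\<close>, and elsewhere the integrand is bounded.
\<close>

theorem integral_finite_of_wiener:
  assumes "(\<lambda>x. complex_of_real (roof K x)) \<in> wiener_algebra"
  shows "(\<integral>\<^sup>+t\<in>{0..1}. ennreal (K t / t * ln (2 / t)) \<partial>lborel) < \<infinity>"
proof -
  obtain M where M: "\<And>\<epsilon>. 0 < \<epsilon> \<Longrightarrow> \<epsilon> \<le> 1 \<Longrightarrow> (\<integral>\<^sup>+t\<in>{\<epsilon>..1}. ennreal (K t / t * ln (1 / t)) \<partial>lborel) \<le> ennreal M"
    using truncated_integral_bounded[OF assms] by blast
  \<comment> \<open>Clamping the argument makes the integrand Borel measurable without any assumption on \<open>K\<close> off the unit interval.\<close>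
  define q where "q t = ennreal (K (max 0 (min 1 t)) / t * ln (1 / t))" for t
  have [measurable]: "q \<in> borel_measurable borel" unfolding q_def by measurable
  have qK: "ennreal (K t / t * ln (1 / t)) * indicator {\<epsilon>..1} t = q t * indicator {\<epsilon>..1} t" if "\<epsilon> > 0" for \<epsilon> t
    using that by (auto simp: q_def indicator_def max_def min_def)
  have "(\<integral>\<^sup>+t. q t * indicator {0<..1} t \<partial>lborel) = (\<integral>\<^sup>+t. (SUP n. q t * indicator {1 / real (Suc n)..1} t) \<partial>lborel)"
  proof (intro nn_integral_cong)
    fix t :: real
    show "q t * indicator {0<..1} t = (SUP n. q t * indicator {1 / real (Suc n)..1} t)"
    proof (cases "t \<in> {0<..1}")
      case True
      then obtain m where "1 / real (Suc m) < t" using reals_Archimedean[of t] by (auto simp: inverse_eq_divide)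
      then have m: "q t * indicator {1 / real (Suc m)..1} t = q t" using True by simp
      show ?thesis
        using True by (intro antisym SUP_least SUP_upper2[of m]) (auto simp: m simp del: of_nat_Suc split: split_indicator)
    next
      case False
      then have "t \<notin> {1 / real (Suc n)..1}" for n
        using order_less_le_trans[of 0 "1 / real (Suc n)" t] by auto
      with False show ?thesis by simp
    qed
  qed
  also have "\<dots> = (SUP n. \<integral>\<^sup>+t. q t * indicator {1 / real (Suc n)..1} t \<partial>lborel)"
  proof (rule nn_integral_monotone_convergence_SUP)
    show "incseq (\<lambda>n t. q t * indicator {1 / real (Suc n)..1} t)"
      unfolding incseq_def le_fun_def
    proof (intro allI impI mult_left_mono indicator_leI)
      fix m n :: nat and t :: real assume "m \<le> n" "t \<in> {1 / real (Suc m)..1}"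
      moreover from \<open>m \<le> n\<close> have "1 / real (Suc n) \<le> 1 / real (Suc m)" by (intro divide_left_mono) auto
      ultimately show "t \<in> {1 / real (Suc n)..1}" by auto
    qed simp
  qed simp
  also have "\<dots> \<le> ennreal M"
    by (intro SUP_least) (use M in \<open>simp add: qK[symmetric]\<close>)
  finally have fin: "(\<integral>\<^sup>+t. q t * indicator {0<..1} t \<partial>lborel) < \<infinity>"
    using ennreal_less_top le_less_trans by (metis infinity_ennreal_def)
  have "(\<integral>\<^sup>+t\<in>{0..1}. ennreal (K t / t * ln (2 / t)) \<partial>lborel) \<le>
     (\<integral>\<^sup>+t. 2 * (q t * indicator {0<..1} t) + ennreal (2 * K 1 * ln 2) * indicator {0..1} t \<partial>lborel)"
  proof (rule nn_integral_mono)
    fix t :: real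
    show "ennreal (K t / t * ln (2 / t)) * indicator {0..1} t \<le> 2 * (q t * indicator {0<..1} t) + ennreal (2 * K 1 * ln 2) * indicator {0..1} t"
    proof (cases "t \<in> {0<..1}")
      case True
      then have K: "0 \<le> K t" "K t \<le> K 1" using K_nonneg K_le_1 by auto
      have q: "q t = ennreal (K t / t * ln (1 / t))" using True by (simp add: q_def)
      have ln: "ln (2 / t) = ln 2 + ln (1 / t)" "0 \<le> ln (1 / t)" using True by (auto simp: ln_div)
      have "K t / t * ln (2 / t) \<le> 2 * (K t / t * ln (1 / t)) + 2 * K 1 * ln 2"
      proof (cases "t \<le> 1 / 2")
        case True
        then have "ln 2 \<le> ln (1 / t)" using \<open>t \<in> {0<..1}\<close> by (subst ln_le_cancel_iff) (auto simp: field_simps)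
        then have "K t / t * ln (2 / t) \<le> K t / t * (2 * ln (1 / t))"
          unfolding ln(1) using K \<open>t \<in> {0<..1}\<close> by (intro mult_left_mono) auto
        also have "\<dots> = 2 * (K t / t * ln (1 / t))" by simp
        also have "\<dots> \<le> \<dots> + 2 * K 1 * ln 2" using K by simp
        finally show ?thesis .
      next
        case False
        have "K t / t \<le> K 1 / (1 / 2)" using False K by (intro frac_le) auto
        then have "K t / t * ln 2 \<le> 2 * K 1 * ln 2" by (intro mult_right_mono) auto
        moreover have "0 \<le> K t / t * ln (1 / t)" using K ln \<open>t \<in> {0<..1}\<close> by simp
        ultimately show ?thesis unfolding ln(1) distrib_left by linarith
      qed
      then have "ennreal (K t / t * ln (2 / t)) \<le> ennreal (2 * (K t / t * ln (1 / t)) + 2 * K 1 * ln 2)"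
        by (rule ennreal_leI)
      also have "\<dots> = 2 * q t + ennreal (2 * K 1 * ln 2)"
      proof -
        have "ennreal (2 * x) = 2 * ennreal x" if "x \<ge> 0" for x using that by (simp add: ennreal_mult)
        from this[of "K t / t * ln (1 / t)"] show ?thesis
          unfolding q using K ln True by (subst ennreal_plus) simp_all
      qed
      finally show ?thesis using True by simp
    next
      case False
      then show ?thesis by (auto simp: indicator_def)
    qed
  qed
  also have "\<dots> = 2 * (\<integral>\<^sup>+t. q t * indicator {0<..1} t \<partial>lborel) + ennreal (2 * K 1 * ln 2)"
    by (subst nn_integral_add) (auto simp: nn_integral_cmult)
  also have "\<dots> < \<infinity>" using fin by (simp add: ennreal_mult_less_top)
  finally show ?thesis .
qed

end

section \<open>Integrability of the transform\<close>

lemma nn_integral_inverse_finite: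
  fixes h :: "real \<Rightarrow> real"
  assumes h[measurable]: "h \<in> borel_measurable borel" and h0: "\<And>t. 0 < t \<Longrightarrow> t \<le> 1 \<Longrightarrow> 0 \<le> h t"
    and fin: "(\<integral>\<^sup>+t\<in>{0<..1}. ennreal (h t) \<partial>lborel) < \<infinity>"
  shows "(\<integral>\<^sup>+a\<in>{1..}. ennreal (h (1 / a) / a\<^sup>2) \<partial>lborel) < \<infinity>"
proof -
  have eq: "norm (indicator S x *\<^sub>R k x) = k x * indicator S x" if "\<And>x. x \<in> S \<Longrightarrow> 0 \<le> k x" for S and k :: "real \<Rightarrow> real" and x
    using that by (auto simp: indicator_def)
  have "set_integrable lborel {0<..1} h"
    unfolding set_integrable_def
  proof (rule integrableI_bounded)
    show "(\<integral>\<^sup>+x. ennreal (norm (indicator {0<..1} x *\<^sub>R h x)) \<partial>lborel) < \<infinity>"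
      using fin by (subst eq) (auto simp: h0 nn_integral_set_ennreal)
  qed simp
  then have "h absolutely_integrable_on {0<..1}"
    unfolding set_integrable_def by (rule integrable_completion[THEN iffD2, rotated]) simp
  also have "{0<..1::real} = (\<lambda>a. 1 / a) ` {1..}"
  proof (intro equalityI subsetI)
    fix t :: real assume "t \<in> {0<..1}"
    then show "t \<in> (\<lambda>a. 1 / a) ` {1..}" by (intro image_eqI[of _ _ "1 / t"]) auto
  qed auto
  finally have "(\<lambda>a. \<bar>- (1 / a\<^sup>2)\<bar> *\<^sub>R h (1 / a)) absolutely_integrable_on {1..}"
    by (rule absolutely_integrable_change_of_variables_real[THEN iffD1, rotated 3])
       (auto intro!: derivative_eq_intros inj_onI simp: power2_eq_square)
  then have "integrable lborel (\<lambda>a. indicator {1..} a *\<^sub>R (\<bar>- (1 / a\<^sup>2)\<bar> *\<^sub>R h (1 / a)))"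
    unfolding set_integrable_def by (rule integrable_completion[THEN iffD1, rotated]) simp
  then have "(\<integral>\<^sup>+a. ennreal (norm (indicator {1..} a *\<^sub>R (\<bar>- (1 / a\<^sup>2)\<bar> *\<^sub>R h (1 / a)))) \<partial>lborel) < \<infinity>"
    by (simp add: integrable_iff_bounded)
  also have "(\<integral>\<^sup>+a. ennreal (norm (indicator {1..} a *\<^sub>R (\<bar>- (1 / a\<^sup>2)\<bar> *\<^sub>R h (1 / a)))) \<partial>lborel) = (\<integral>\<^sup>+a\<in>{1..}. ennreal (h (1 / a) / a\<^sup>2) \<partial>lborel)"
    by (intro nn_integral_cong) (auto simp: indicator_def h0)
  finally show ?thesis .
qed

lemma nn_integral_abs_le:
  fixes \<phi> :: "real \<Rightarrow> ennreal"
  assumes [measurable]: "\<phi> \<in> borel_measurable borel"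
  shows "(\<integral>\<^sup>+y. \<phi> \<bar>y\<bar> \<partial>lborel) \<le> 2 * (\<integral>\<^sup>+y\<in>{0..}. \<phi> y \<partial>lborel)"
proof -
  have "(\<integral>\<^sup>+y. \<phi> \<bar>y\<bar> \<partial>lborel) \<le> (\<integral>\<^sup>+y. \<phi> y * indicator {0..} y + \<phi> (- y) * indicator {0..} (- y) \<partial>lborel)"
    by (rule nn_integral_mono) (auto simp: indicator_def abs_if)
  also have "\<dots> = (\<integral>\<^sup>+y\<in>{0..}. \<phi> y \<partial>lborel) + (\<integral>\<^sup>+y. \<phi> (- y) * indicator {0..} (- y) \<partial>lborel)"
    by (rule nn_integral_add) measurable
  also have "(\<integral>\<^sup>+y. \<phi> (- y) * indicator {0..} (- y) \<partial>lborel) = (\<integral>\<^sup>+y\<in>{0..}. \<phi> y \<partial>lborel)"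
    by (subst (2) nn_integral_real_affine[where c="-1" and t=0]) simp_all
  finally show ?thesis by (simp add: mult_2)
qed

lemma nn_integral_inverse_max:
  assumes "a \<ge> 0"
  shows "(\<integral>\<^sup>+b\<in>{0..a}. ennreal (1 / max 1 b) \<partial>lborel) \<le> ennreal (1 + ln (max 1 a))"
proof -
  have "(\<integral>\<^sup>+b\<in>{0..a}. ennreal (1 / max 1 b) \<partial>lborel) \<le> (\<integral>\<^sup>+b. indicator {0..1} b + ennreal (1 / b) * indicator {1..max 1 a} b \<partial>lborel)"
    by (rule nn_integral_mono) (auto simp: indicator_def max_def)
  also have "\<dots> = 1 + (\<integral>\<^sup>+b. ennreal (1 / b) * indicator {1..max 1 a} b \<partial>lborel)"
    by (subst nn_integral_add) auto
  also have "(\<integral>\<^sup>+b. ennreal (1 / b) * indicator {1..max 1 a} b \<partial>lborel) = ln (max 1 a) - ln 1"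
    by (rule nn_integral_FTC_Icc) (auto intro!: derivative_eq_intros)
  finally show ?thesis by (simp add: ennreal_plus)
qed

text \<open>The reflection \<open>b \<mapsto> a - b\<close> of \<open>[0, a]\<close> exchanges the axis term and the diagonal term.\<close>

lemma nn_integral_ridge_weight:
  assumes a: "a \<ge> 0"
  shows "(\<integral>\<^sup>+b\<in>{0..a}. ennreal (ridge_weight a b) \<partial>lborel) \<le> ennreal (2 * ((1 + ln (max 1 a)) / max 1 a))"
proof -
  let ?I = "\<integral>\<^sup>+b\<in>{0..a}. ennreal (1 / max 1 b) \<partial>lborel"
  have "(\<integral>\<^sup>+b\<in>{0..a}. ennreal (ridge_weight a b) \<partial>lborel) = (\<integral>\<^sup>+b. ennreal (1 / max 1 a) * (ennreal (1 / max 1 b) * indicator {0..a} b + ennreal (1 / max 1 (a - b)) * indicator {0..a} b) \<partial>lborel)"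
    by (intro nn_integral_cong) (auto simp: ridge_weight_def indicator_def simp flip: ennreal_plus ennreal_mult)
  also have "\<dots> = ennreal (1 / max 1 a) * (?I + (\<integral>\<^sup>+b. ennreal (1 / max 1 (a - b)) * indicator {0..a} b \<partial>lborel))"
    by (subst nn_integral_cmult, simp, subst nn_integral_add) simp_all
  also have "(\<integral>\<^sup>+b. ennreal (1 / max 1 (a - b)) * indicator {0..a} b \<partial>lborel) = ?I"
    by (subst nn_integral_real_affine[where c="-1" and t=a]) (auto intro!: nn_integral_cong simp: indicator_def)
  also have "ennreal (1 / max 1 a) * (?I + ?I) \<le> ennreal (1 / max 1 a) * (ennreal (1 + ln (max 1 a)) + ennreal (1 + ln (max 1 a)))"
    by (intro mult_left_mono add_mono nn_integral_inverse_max a) auto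
  also have "\<dots> = ennreal (2 * ((1 + ln (max 1 a)) / max 1 a))"
    by (simp add: field_simps flip: ennreal_plus ennreal_mult)
  finally show ?thesis .
qed

context concave_profile
begin

definition radial :: "real \<Rightarrow> real" where "radial a = 16 * K (1 / max 1 a)"

lemma measurable_radial[measurable]: "radial \<in> borel_measurable borel"
  unfolding radial_def[abs_def]
  by (intro borel_measurable_continuous_onI continuous_on_mult continuous_on_const continuous_on_compose2[OF cont]) (auto intro!: continuous_intros)

lemma radial_nonneg: "0 \<le> radial a"
  unfolding radial_def by (intro mult_nonneg_nonneg K_nonneg) auto

text \<open>
  The range \<open>a \<le> 1\<close> contributes a constant.  For \<open>a \<ge> 1\<close> one has \<open>1 + ln a \<le> 2 ln (2 a)\<close>, and the substitution
  \<open>t = 1 / a\<close> leads to the integral in the assumption.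
\<close>

lemma radial_integral_finite:
  assumes "(\<integral>\<^sup>+t\<in>{0..1}. ennreal (K t / t * ln (2 / t)) \<partial>lborel) < \<infinity>"
  shows "(\<integral>\<^sup>+a\<in>{0..}. ennreal (radial a * (2 * ((1 + ln (max 1 a)) / max 1 a))) \<partial>lborel) < \<infinity>"
proof -
  define h where "h t = K (max 0 (min 1 t)) / t * ln (2 / t)" for t
  have h_meas[measurable]: "h \<in> borel_measurable borel" unfolding h_def by measurable
  have hK: "h t = K t / t * ln (2 / t)" if "0 < t" "t \<le> 1" for t using that by (simp add: h_def)
  have h0: "0 \<le> h t" if "0 < t" "t \<le> 1" for t
    unfolding hK[OF that] using that K_nonneg by (intro mult_nonneg_nonneg divide_nonneg_nonneg) auto
  have "(\<integral>\<^sup>+t\<in>{0<..1}. ennreal (h t) \<partial>lborel) \<le> (\<integral>\<^sup>+t\<in>{0..1}. ennreal (K t / t * ln (2 / t)) \<partial>lborel)"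
    by (rule nn_integral_mono) (auto simp: indicator_def hK)
  also note assms
  finally have fin: "(\<integral>\<^sup>+a\<in>{1..}. ennreal (h (1 / a) / a\<^sup>2) \<partial>lborel) < \<infinity>"
    using h0 by (intro nn_integral_inverse_finite) auto
  have "(\<integral>\<^sup>+a\<in>{0..}. ennreal (radial a * (2 * ((1 + ln (max 1 a)) / max 1 a))) \<partial>lborel) \<le>
     (\<integral>\<^sup>+a. ennreal (32 * K 1) * indicator {0..1} a + 64 * (ennreal (h (1 / a) / a\<^sup>2) * indicator {1..} a) \<partial>lborel)"
  proof (rule nn_integral_mono)
    fix a :: real
    show "ennreal (radial a * (2 * ((1 + ln (max 1 a)) / max 1 a))) * indicator {0..} a \<le>
      ennreal (32 * K 1) * indicator {0..1} a + 64 * (ennreal (h (1 / a) / a\<^sup>2) * indicator {1..} a)"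
    proof (cases "a \<ge> 1")
      case True
      have Kn: "0 \<le> K (1 / a)" using True by (intro K_nonneg) auto
      have l2: "1 / 2 \<le> ln (2::real)" using ln_2_less_1 ln2_ge_two_thirds by linarith
      have "ln (2 * a) = ln 2 + ln a" using True by (simp add: ln_mult)
      with l2 ln_ge_zero[OF True] have key: "1 + ln a \<le> 2 * ln (2 * a)" by linarith
      have "radial a * (2 * ((1 + ln (max 1 a)) / max 1 a)) = 32 * (K (1 / a) / a) * (1 + ln a)"
        using True by (simp add: radial_def max_absorb2)
      also have "\<dots> \<le> 32 * (K (1 / a) / a) * (2 * ln (2 * a))"
        using True Kn by (intro mult_left_mono key) auto
      also have "\<dots> = 64 * (h (1 / a) / a\<^sup>2)"
        using True by (simp add: hK power2_eq_square field_simps)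
      finally have "ennreal (radial a * (2 * ((1 + ln (max 1 a)) / max 1 a))) \<le> ennreal (64 * (h (1 / a) / a\<^sup>2))"
        by (rule ennreal_leI)
      also have "\<dots> = 64 * ennreal (h (1 / a) / a\<^sup>2)"
        using h0[of "1 / a"] True by (subst ennreal_mult) auto
      finally show ?thesis using True by (auto intro: order_trans)
    next
      case False
      then show ?thesis by (auto simp: radial_def indicator_def max_def)
    qed
  qed
  also have "\<dots> = ennreal (32 * K 1) + 64 * (\<integral>\<^sup>+a\<in>{1..}. ennreal (h (1 / a) / a\<^sup>2) \<partial>lborel)"
    by (subst nn_integral_add) (auto simp: nn_integral_cmult)
  also have "\<dots> < \<infinity>" using fin by (simp add: ennreal_mult_less_top)
  finally show ?thesis .
qed

text \<open>
  By symmetry in the two coordinates and in their signs it is enough to integrate the bound over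
  \<open>0 \<le> b \<le> a\<close>.  The pointwise bound is missing on the coordinate axes, which are null sets.
\<close>

lemma integrable_ft_roof:
  assumes "(\<integral>\<^sup>+t\<in>{0..1}. ennreal (K t / t * ln (2 / t)) \<partial>lborel) < \<infinity>"
  shows "integrable lborel (ft (\<lambda>x. complex_of_real (roof K x)))"
proof (rule integrableI_bounded)
  let ?H = "ft (\<lambda>x. complex_of_real (roof K x))"
  have meas: "?H \<in> borel_measurable borel" by (rule measurable_ft) simp
  then show "?H \<in> borel_measurable lborel" by simp
  define W where "W a b = ennreal (radial a * ridge_weight a b) * indicator {0..a} b" for a b :: real
  have W_eq: "W a b = ennreal (radial a * ridge_weight a b) * (if 0 \<le> b \<and> b \<le> a then 1 else 0)" for a b
    by (simp add: W_def)
  have W_meas[measurable]: "(\<lambda>(a, b). W \<bar>a\<bar> \<bar>b\<bar>) \<in> borel_measurable (lborel \<Otimes>\<^sub>M lborel)"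
    unfolding W_eq ridge_weight_def by measurable
  have W_meas': "(\<lambda>(a, b). W \<bar>b\<bar> \<bar>a\<bar>) \<in> borel_measurable (lborel \<Otimes>\<^sub>M lborel)"
    unfolding W_eq ridge_weight_def by measurable
  have W_meas2[measurable]: "W a \<in> borel_measurable borel" for a
    unfolding W_def[abs_def] ridge_weight_def by measurable
  have "(\<integral>\<^sup>+y. ennreal (norm (?H y)) \<partial>lborel) = (\<integral>\<^sup>+y1. \<integral>\<^sup>+y2. ennreal (norm (?H (y1, y2))) \<partial>lborel \<partial>lborel)"
    using meas by (subst lborel.nn_integral_fst) (simp_all add: lborel_prod)
  also have "\<dots> \<le> (\<integral>\<^sup>+y1. \<integral>\<^sup>+y2. W \<bar>y1\<bar> \<bar>y2\<bar> + W \<bar>y2\<bar> \<bar>y1\<bar> \<partial>lborel \<partial>lborel)"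
  proof (rule nn_integral_mono_AE, rule eventually_mono[OF AE_lborel_singleton[of 0]])
    fix y1 :: real assume y1: "y1 \<noteq> 0"
    show "(\<integral>\<^sup>+y2. ennreal (norm (?H (y1, y2))) \<partial>lborel) \<le> (\<integral>\<^sup>+y2. W \<bar>y1\<bar> \<bar>y2\<bar> + W \<bar>y2\<bar> \<bar>y1\<bar> \<partial>lborel)"
    proof (rule nn_integral_mono_AE, rule eventually_mono[OF AE_lborel_singleton[of 0]])
      fix y2 :: real assume y2: "y2 \<noteq> 0"
      have "ennreal (norm (?H (y1, y2))) \<le> ennreal (radial (max \<bar>y1\<bar> \<bar>y2\<bar>) * ridge_weight (max \<bar>y1\<bar> \<bar>y2\<bar>) (min \<bar>y1\<bar> \<bar>y2\<bar>))"
        using ft_roof_bound[of "(y1, y2)"] y1 y2 by (intro ennreal_leI) (simp add: radial_def)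
      also have "\<dots> \<le> W \<bar>y1\<bar> \<bar>y2\<bar> + W \<bar>y2\<bar> \<bar>y1\<bar>"
        by (cases "\<bar>y2\<bar> \<le> \<bar>y1\<bar>") (auto simp: W_def max_def min_def)
      finally show "ennreal (norm (?H (y1, y2))) \<le> W \<bar>y1\<bar> \<bar>y2\<bar> + W \<bar>y2\<bar> \<bar>y1\<bar>" .
    qed
  qed
  also have "\<dots> = (\<integral>\<^sup>+y1. (\<integral>\<^sup>+y2. W \<bar>y1\<bar> \<bar>y2\<bar> \<partial>lborel) + (\<integral>\<^sup>+y2. W \<bar>y2\<bar> \<bar>y1\<bar> \<partial>lborel) \<partial>lborel)"
    by (intro nn_integral_cong nn_integral_add) (use measurable_compose[OF measurable_Pair1' W_meas] measurable_compose[OF measurable_Pair2' W_meas] in auto)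
  also have "\<dots> = (\<integral>\<^sup>+y1. (\<integral>\<^sup>+y2. W \<bar>y1\<bar> \<bar>y2\<bar> \<partial>lborel) \<partial>lborel) + (\<integral>\<^sup>+y1. (\<integral>\<^sup>+y2. W \<bar>y2\<bar> \<bar>y1\<bar> \<partial>lborel) \<partial>lborel)"
    by (intro nn_integral_add lborel.borel_measurable_nn_integral)
       (use W_meas W_meas' in \<open>simp_all add: case_prod_beta'\<close>)
  also have "(\<integral>\<^sup>+y1. (\<integral>\<^sup>+y2. W \<bar>y2\<bar> \<bar>y1\<bar> \<partial>lborel) \<partial>lborel) = (\<integral>\<^sup>+y1. (\<integral>\<^sup>+y2. W \<bar>y1\<bar> \<bar>y2\<bar> \<partial>lborel) \<partial>lborel)"
    by (rule lborel_pair.Fubini'[OF W_meas])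
  finally have le: "(\<integral>\<^sup>+y. ennreal (norm (?H y)) \<partial>lborel) \<le> 2 * (\<integral>\<^sup>+y1. (\<integral>\<^sup>+y2. W \<bar>y1\<bar> \<bar>y2\<bar> \<partial>lborel) \<partial>lborel)"
    by (simp add: mult_2)
  have inner: "(\<integral>\<^sup>+y2. W a \<bar>y2\<bar> \<partial>lborel) \<le> 2 * ennreal (radial a * (2 * ((1 + ln (max 1 a)) / max 1 a)))" if "a \<ge> 0" for a
  proof -
    have "(\<integral>\<^sup>+y2. W a \<bar>y2\<bar> \<partial>lborel) \<le> 2 * (\<integral>\<^sup>+b\<in>{0..}. W a b \<partial>lborel)"
      by (rule nn_integral_abs_le) measurable
    also have "(\<integral>\<^sup>+b\<in>{0..}. W a b \<partial>lborel) = (\<integral>\<^sup>+b. ennreal (radial a) * (ennreal (ridge_weight a b) * indicator {0..a} b) \<partial>lborel)"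
      by (intro nn_integral_cong) (auto simp: W_def indicator_def ennreal_mult'[OF radial_nonneg])
    also have "\<dots> = ennreal (radial a) * (\<integral>\<^sup>+b\<in>{0..a}. ennreal (ridge_weight a b) \<partial>lborel)"
      by (rule nn_integral_cmult) (simp add: ridge_weight_def)
    also have "\<dots> \<le> ennreal (radial a) * ennreal (2 * ((1 + ln (max 1 a)) / max 1 a))"
      by (intro mult_left_mono nn_integral_ridge_weight that) simp
    also have "\<dots> = ennreal (radial a * (2 * ((1 + ln (max 1 a)) / max 1 a)))"
      by (rule ennreal_mult'[OF radial_nonneg, symmetric])
    finally show ?thesis by (simp add: mult_left_mono)
  qed
  have "(\<integral>\<^sup>+y1. (\<integral>\<^sup>+y2. W \<bar>y1\<bar> \<bar>y2\<bar> \<partial>lborel) \<partial>lborel) \<le> (\<integral>\<^sup>+y1. 2 * ennreal (radial \<bar>y1\<bar> * (2 * ((1 + ln (max 1 \<bar>y1\<bar>)) / max 1 \<bar>y1\<bar>))) \<partial>lborel)"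
    by (intro nn_integral_mono inner) simp
  also have "\<dots> \<le> 2 * (\<integral>\<^sup>+a\<in>{0..}. 2 * ennreal (radial a * (2 * ((1 + ln (max 1 a)) / max 1 a))) \<partial>lborel)"
    by (rule nn_integral_abs_le[of "\<lambda>a. 2 * ennreal (radial a * (2 * ((1 + ln (max 1 a)) / max 1 a)))"]) measurable
  also have "\<dots> = 4 * (\<integral>\<^sup>+a\<in>{0..}. ennreal (radial a * (2 * ((1 + ln (max 1 a)) / max 1 a))) \<partial>lborel)"
    by (simp add: mult.assoc nn_integral_cmult)
  also have "\<dots> < \<infinity>"
    using radial_integral_finite[OF assms] by (simp add: ennreal_mult_less_top)
  finally have "(\<integral>\<^sup>+y1. (\<integral>\<^sup>+y2. W \<bar>y1\<bar> \<bar>y2\<bar> \<partial>lborel) \<partial>lborel) < \<infinity>" .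
  then show "(\<integral>\<^sup>+y. ennreal (norm (?H y)) \<partial>lborel) < \<infinity>"
    by (intro le_less_trans[OF le]) (simp add: ennreal_mult_less_top)
qed

theorem wiener_of_integral_finite:
  assumes "(\<integral>\<^sup>+t\<in>{0..1}. ennreal (K t / t * ln (2 / t)) \<partial>lborel) < \<infinity>"
  shows "(\<lambda>x. complex_of_real (roof K x)) \<in> wiener_algebra"
proof (rule fourier_inversion[where M="K 1"])
  show "continuous_on UNIV (\<lambda>x. complex_of_real (roof K x))"
    by (intro continuous_intros continuous_roof)
  show "norm (complex_of_real (roof K x)) \<le> K 1" for x
    using roof_nonneg[of x] roof_le[of x] by simp
qed (rule integrable_roof integrable_ft_roof[OF assms])+

end

section \<open>The criterion\<close>

theorem mainTheorem4:
  fixes f\<^sub>0 :: "real \<Rightarrow> real"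
  assumes "continuous_on {0..} f\<^sub>0"
    and "\<And>t. t \<ge> 1 \<Longrightarrow> f\<^sub>0 t = 0"
    and "antimono_on {0..1} f\<^sub>0"
    and "concave_on {0..1} f\<^sub>0"
  shows "(\<lambda>x :: real^2. complex_of_real (f\<^sub>0 (max \<bar>x$1\<bar> \<bar>x$2\<bar>))) \<in> wiener_algebra \<longleftrightarrow>
         (\<integral>\<^sup>+t\<in>{0..1}. ennreal (f\<^sub>0 (1 - t) / t * ln (2 / t)) \<partial>lborel) < \<infinity>"
proof -
  define K where "K t = f\<^sub>0 (1 - t)" for t
  interpret concave_profile K
  proof
    show "K 0 = 0" by (simp add: K_def assms(2))
    show "mono_on {0..1} K"
      using monotone_onD[OF assms(3)] by (intro mono_onI) (auto simp: K_def)
    show "concave_on {0..1} K"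
      unfolding concave_on_iff
    proof (intro conjI ballI allI impI)
      fix x y u v :: real assume xy: "x \<in> {0..1}" "y \<in> {0..1}" and uv: "0 \<le> u" "0 \<le> v" "u + v = 1"
      have "1 - (u * x + v * y) = u * (1 - x) + v * (1 - y)" using uv(3) by (simp add: algebra_simps)
      then show "K (u *\<^sub>R x + v *\<^sub>R y) \<ge> u * K x + v * K y"
        using assms(4)[unfolded concave_on_iff] xy uv by (simp add: K_def)
    qed simp
    show "continuous_on {0..1} K"
      unfolding K_def by (rule continuous_on_compose2[OF assms(1)]) (auto intro!: continuous_intros)
  qed
  have "f\<^sub>0 m = K (max 0 (1 - m))" if "m \<ge> 0" for m
    using that by (cases "m \<le> 1") (auto simp: K_def assms(2) max_def)
  then have "f\<^sub>0 (max \<bar>a\<bar> \<bar>b\<bar>) = roof K (a, b)" for a b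
    by (simp add: roof_def)
  then have "(\<lambda>x :: real^2. complex_of_real (f\<^sub>0 (max \<bar>x$1\<bar> \<bar>x$2\<bar>))) \<in> wiener_algebra \<longleftrightarrow>
     (\<lambda>x. complex_of_real (roof K x)) \<in> wiener_algebra"
    using wiener_algebra_vec2[of "\<lambda>a b. complex_of_real (f\<^sub>0 (max \<bar>a\<bar> \<bar>b\<bar>))"] by simp
  also have "\<dots> \<longleftrightarrow> (\<integral>\<^sup>+t\<in>{0..1}. ennreal (K t / t * ln (2 / t)) \<partial>lborel) < \<infinity>"
    using integral_finite_of_wiener wiener_of_integral_finite by blast
  finally show ?thesis by (simp add: K_def)
qed

end
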